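(* The Shortest Path Discovery problem in the token sliding model is fixed-parameter tractable with respect to the parameter $b$. The problem: given a graph $G$, vertices $s,t\in V(G)$, a vertex set $S\subseteq V(G)$ whose size equals the number of vertices (including $s$ and $t$) of a shortest $s$-$t$-path, and a non-negative integer $b$, decide whether there is a discovery sequence $C_0\dots C_\ell$ in the token sliding model with $C_0=S$, $\ell\le b$, and $C_\ell$ the vertex set of a shortest $s$-$t$-path.
   Context: A configuration is a set of vertices (one token on each). In the token sliding model, $C'$ is obtained in one step from $C$ if $C'=(C\setminus\{y\})\cup\{x\}$ with $y\in C$, $x\notin C$, $xy\in E(G)$. A discovery sequence of length $\ell$ is a sequence $C_0\dots C_\ell$ with each $C_{i+1}$ obtained in one step from $C_i$. Fixed-parameter tractable means solvable in time $f(b)\cdot N^{c}$ for a computable $f$, constant $c$, and input size $N$. *)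

theory Defs
  imports "Graph_Theory.Pair_Digraph" "HOL-Library.Log_Nat"
begin

section \<open>Machine model\<close>

text \<open>
  Running times refer to a random access machine with unbounded registers holding natural numbers
  and finitely many (per program) random access arrays, programmed in structured form.
  Every operation has unit cost. Multiplication is deliberately not an operation: each unit of
  time at most doubles the largest number present (addition), so numbers have
  polynomially long binary representations and the model is polynomially equivalent to
  Turing machines.
\<close>

datatype aexp =
    Const nat
  | Reg string
  | Load string aexp
  | Plus aexp aexp
  | Minus aexp aexp
  | Half aexp

datatype com =
    Skip
  | Assign string aexp
  | Store string aexp aexp
  | Seq com com
  | IfNz aexp com com
  | WhileNz aexp com

record state =
  regs :: "string \<Rightarrow> nat"
  arrays :: "string \<Rightarrow> nat \<Rightarrow> nat"

primrec aval :: "aexp \<Rightarrow> state \<Rightarrow> nat" where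
  "aval (Const k) \<sigma> = k"
| "aval (Reg r) \<sigma> = regs \<sigma> r"
| "aval (Load m a) \<sigma> = arrays \<sigma> m (aval a \<sigma>)"
| "aval (Plus a b) \<sigma> = aval a \<sigma> + aval b \<sigma>"
| "aval (Minus a b) \<sigma> = aval a \<sigma> - aval b \<sigma>"
| "aval (Half a) \<sigma> = aval a \<sigma> div 2"

primrec acost :: "aexp \<Rightarrow> nat" where
  "acost (Const k) = 1"
| "acost (Reg r) = 1"
| "acost (Load m a) = Suc (acost a)"
| "acost (Plus a b) = Suc (acost a + acost b)"
| "acost (Minus a b) = Suc (acost a + acost b)"
| "acost (Half a) = Suc (acost a)"

definition set_reg :: "string \<Rightarrow> nat \<Rightarrow> state \<Rightarrow> state" where
  "set_reg r v \<sigma> = \<sigma>\<lparr>regs := (regs \<sigma>)(r := v)\<rparr>"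

definition set_cell :: "string \<Rightarrow> nat \<Rightarrow> nat \<Rightarrow> state \<Rightarrow> state" where
  "set_cell m i v \<sigma> = \<sigma>\<lparr>arrays := (arrays \<sigma>)(m := (arrays \<sigma> m)(i := v))\<rparr>"

text \<open>
  \<open>exec c \<sigma> k \<sigma>'\<close>: started in \<open>\<sigma>\<close>, the program \<open>c\<close> halts after exactly \<open>k\<close> steps in \<open>\<sigma>'\<close>.
\<close>

inductive exec :: "com \<Rightarrow> state \<Rightarrow> nat \<Rightarrow> state \<Rightarrow> bool" where
  exec_Skip: "exec Skip \<sigma> 1 \<sigma>"
| exec_Assign: "exec (Assign r a) \<sigma> (Suc (acost a)) (set_reg r (aval a \<sigma>) \<sigma>)"
| exec_Store: "exec (Store m a b) \<sigma> (Suc (acost a + acost b)) (set_cell m (aval a \<sigma>) (aval b \<sigma>) \<sigma>)"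
| exec_Seq: "exec c \<sigma> k \<sigma>' \<Longrightarrow> exec d \<sigma>' l \<sigma>'' \<Longrightarrow> exec (Seq c d) \<sigma> (k + l) \<sigma>''"
| exec_If_true: "aval a \<sigma> \<noteq> 0 \<Longrightarrow> exec c \<sigma> k \<sigma>' \<Longrightarrow> exec (IfNz a c d) \<sigma> (Suc (acost a + k)) \<sigma>'"
| exec_If_false: "aval a \<sigma> = 0 \<Longrightarrow> exec d \<sigma> k \<sigma>' \<Longrightarrow> exec (IfNz a c d) \<sigma> (Suc (acost a + k)) \<sigma>'"
| exec_While_false: "aval a \<sigma> = 0 \<Longrightarrow> exec (WhileNz a c) \<sigma> (Suc (acost a)) \<sigma>"
| exec_While_true: "aval a \<sigma> \<noteq> 0 \<Longrightarrow> exec c \<sigma> k \<sigma>' \<Longrightarrow> exec (WhileNz a c) \<sigma>' l \<sigma>'' \<Longrightarrow>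
    exec (WhileNz a c) \<sigma> (Suc (acost a + k + l)) \<sigma>''"

lemma exec_deterministic:
  "exec c \<sigma> k \<sigma>' \<Longrightarrow> exec c \<sigma> l \<sigma>'' \<Longrightarrow> l = k \<and> \<sigma>'' = \<sigma>'"
proof (induction arbitrary: l \<sigma>'' rule: exec.induct)
  case (exec_Skip \<sigma>)
  from exec_Skip.prems show ?case
    by cases (simp_all)
next
  case (exec_Assign r a \<sigma>)
  from exec_Assign.prems show ?case
    by cases (simp_all)
next
  case (exec_Store m a b \<sigma>)
  from exec_Store.prems show ?case
    by cases (simp_all)
next
  case (exec_Seq c \<sigma> k \<sigma>' d k' \<tau>)
  from exec_Seq.prems show ?case
    by cases (metis exec_Seq.IH)
next
  case (exec_If_true a \<sigma> c k \<sigma>' d)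
  from exec_If_true.prems show ?case
    by cases (metis exec_If_true.IH, use exec_If_true.hyps(1) in simp)
next
  case (exec_If_false a \<sigma> d k \<sigma>' c)
  from exec_If_false.prems show ?case
    by cases (use exec_If_false.hyps(1) in simp, metis exec_If_false.IH)
next
  case (exec_While_false a \<sigma> c)
  from exec_While_false.prems show ?case
    by cases (use exec_While_false.hyps in simp_all)
next
  case (exec_While_true a \<sigma> c k \<sigma>' k' \<tau>)
  from exec_While_true.prems show ?case
    by cases (use exec_While_true.hyps(1) in simp, metis exec_While_true.IH)
qed

text \<open>
  The input word is in the array \<open>in\<close>, its length in the register \<open>len\<close>; everything else
  is initially zero. The result is left in the register \<open>out\<close>.
\<close>

definition initial_state :: "nat list \<Rightarrow> state" where
  "initial_state w =
     \<lparr>regs = (\<lambda>_. 0)(''len'' := length w),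
      arrays = (\<lambda>_ _. 0)(''in'' := (\<lambda>i. if i < length w then w ! i else 0))\<rparr>"

definition halts_with :: "com \<Rightarrow> nat list \<Rightarrow> nat \<Rightarrow> nat \<Rightarrow> bool" where
  "halts_with c w k v \<longleftrightarrow> (\<exists>\<sigma>. exec c (initial_state w) k \<sigma> \<and> regs \<sigma> ''out'' = v)"

definition computable :: "(nat \<Rightarrow> nat) \<Rightarrow> bool" where
  "computable f \<longleftrightarrow> (\<exists>c. \<forall>n. \<exists>k. halts_with c [n] k (f n))"

text \<open>
  Number of bits of the input; the number 0 still occupies one bit.
\<close>

definition input_size :: "nat list \<Rightarrow> nat" where
  "input_size w = (\<Sum>x\<leftarrow>w. max 1 (floorlog 2 x))"

text \<open>
  A parameterized decision problem is given by its set \<open>I\<close> of instances, their encoding as input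
  words, the parameter and the set \<open>Y\<close> of yes-instances.
\<close>

definition fixed_parameter_tractable ::
    "'i set \<Rightarrow> ('i \<Rightarrow> nat list) \<Rightarrow> ('i \<Rightarrow> nat) \<Rightarrow> 'i set \<Rightarrow> bool" where
  "fixed_parameter_tractable I enc param Y \<longleftrightarrow>
     (\<exists>prog f c. computable f \<and>
        (\<forall>x\<in>I. \<exists>k. k \<le> f (param x) * input_size (enc x) ^ c \<and>
                   halts_with prog (enc x) k (if x \<in> Y then 1 else 0)))"


section \<open>Token sliding and shortest path discovery\<close>

text \<open>
  A finite simple undirected graph is a \<^locale>\<open>pair_graph\<close>: a finite loop-free digraph with
  symmetric arc relation. Paths are lists of arcs.
\<close>

definition shortest_path :: "'a pair_pre_digraph \<Rightarrow> 'a \<Rightarrow> ('a \<times> 'a) list \<Rightarrow> 'a \<Rightarrow> bool" where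
  "shortest_path G s p t \<longleftrightarrow>
     pre_digraph.apath (with_proj G) s p t \<and>
     (\<forall>q. pre_digraph.apath (with_proj G) s q t \<longrightarrow> length p \<le> length q)"

definition path_vertices :: "'a \<Rightarrow> ('a \<times> 'a) list \<Rightarrow> 'a set" where
  "path_vertices s p = set (pawalk_verts s p)"

definition sliding_step :: "'a pair_pre_digraph \<Rightarrow> 'a set \<Rightarrow> 'a set \<Rightarrow> bool" where
  "sliding_step G C C' \<longleftrightarrow>
     (\<exists>x y. y \<in> C \<and> x \<notin> C \<and> (x, y) \<in> parcs G \<and> C' = (C - {y}) \<union> {x})"

definition discovery_sequence :: "'a pair_pre_digraph \<Rightarrow> (nat \<Rightarrow> 'a set) \<Rightarrow> nat \<Rightarrow> bool" where
  "discovery_sequence G C l \<longleftrightarrow>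
     (\<forall>i\<le>l. C i \<subseteq> pverts G) \<and> (\<forall>i<l. sliding_step G (C i) (C (Suc i)))"

record spd_instance =
  spd_graph :: "nat pair_pre_digraph"
  spd_s :: nat
  spd_t :: nat
  spd_S :: "nat set"
  spd_b :: nat

text \<open>
  So that instances can be written down as input words, the vertices are \<open>0, \<dots>, n - 1\<close>.
\<close>

definition spd_instances :: "spd_instance set" where
  "spd_instances =
     {x. pair_graph (spd_graph x) \<and>
         (\<exists>n. pverts (spd_graph x) = {..<n}) \<and>
         spd_s x \<in> pverts (spd_graph x) \<and>
         spd_t x \<in> pverts (spd_graph x) \<and>
         spd_S x \<subseteq> pverts (spd_graph x) \<and>
         (\<exists>p. shortest_path (spd_graph x) (spd_s x) p (spd_t x) \<and>
              card (spd_S x) = card (path_vertices (spd_s x) p))}"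

definition spd_yes_instances :: "spd_instance set" where
  "spd_yes_instances =
     {x \<in> spd_instances.
        \<exists>C l p. discovery_sequence (spd_graph x) C l \<and>
                C 0 = spd_S x \<and>
                l \<le> spd_b x \<and>
                shortest_path (spd_graph x) (spd_s x) p (spd_t x) \<and>
                C l = path_vertices (spd_s x) p}"

text \<open>
  The number of vertices, \<open>s\<close>, \<open>t\<close>, \<open>b\<close>, the characteristic vector of \<open>S\<close>
  and the rows of the adjacency matrix.
\<close>

definition spd_encode :: "spd_instance \<Rightarrow> nat list" where
  "spd_encode x =
     (let n = card (pverts (spd_graph x)) in
      [n, spd_s x, spd_t x, spd_b x] @
      map (\<lambda>v. if v \<in> spd_S x then 1 else 0) [0..<n] @
      concat (map (\<lambda>u. map (\<lambda>v. if (u, v) \<in> parcs (spd_graph x) then 1 else 0) [0..<n]) [0..<n]))"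

end

theory Submission
  imports Defs
begin

text \<open>
  Collisions do not matter: \<open>P\<close> can be reached from \<open>S\<close> in \<open>b\<close> slides iff there is a bijection
  \<open>S \<rightarrow> P\<close> along walks of total length at most \<open>b\<close>. So one looks for a shortest path
  \<open>v\<^sub>0 \<dots> v\<^sub>d\<close> and a cheap assignment of tokens to the \<open>v\<^sub>i\<close>. Order the tokens by their distance
  from \<open>s\<close>. A token moves at most \<open>b\<close> steps and \<open>v\<^sub>i\<close> has distance exactly \<open>i\<close> from \<open>s\<close>, so
  \<open>v\<^sub>i\<close> receives one of the tokens number \<open>i - 2b, \<dots>, i + 2b\<close>. Dynamic programming along the path
  therefore only has to remember \<open>v\<^sub>i\<close>, a bit mask of length \<open>4b + 1\<close> for the tokens of the current
  window that are used, and the cost so far. Tokens that leave the window unused need no test,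
  because there are exactly as many tokens as path vertices.

  The algorithm is written as a loop program whose loop bounds are registers it never changes;
  the running time of such a program is polynomial in the largest of these bounds.
\<close>

section \<open>Loop programs\<close>

text \<open>The search is for walks, never for shortest paths: the instance condition gives
  \<open>card S = d + 1\<close> with \<open>d\<close> the distance from \<open>s\<close> to
  \<open>t\<close>, so every \<open>s\<close>-\<open>t\<close> walk with \<open>d\<close> steps is a
  shortest path. The budget \<open>b\<close> is written in binary and may exceed the input size, but
  whatever depends on it alone, including the \<open>2 ^ (4 * b + 1)\<close> masks, goes into the
  parameter factor. Costs are exact sums rather than minima, and walk lengths are tabulated instead
  of distances, so both tables hold flags that are set and never cleared. This monotonicity carries
  the correctness of the nested loops: soundness is an invariant of every single step, and
  completeness follows since each tuple of loop values is visited and what is written there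
  persists. Two features of the machine shape the program: the missing multiplication forces tables
  of multiples for all addresses, and a loop bound must not be written by the program containing the
  loop, so the values of the bounds are computed in separate pieces that run beforehand.\<close>

datatype lcom =
    LSkip
  | LAssign string aexp
  | LStore string aexp aexp
  | LSeq lcom lcom
  | LIf aexp lcom lcom
  | LFor string string lcom

primrec compile :: "lcom \<Rightarrow> com" where
  "compile LSkip = Skip"
| "compile (LAssign r a) = Assign r a"
| "compile (LStore m a b) = Store m a b"
| "compile (LSeq c d) = Seq (compile c) (compile d)"
| "compile (LIf a c d) = IfNz a (compile c) (compile d)"
| "compile (LFor r N c) =
     Seq (Assign r (Const 0))
       (WhileNz (Minus (Reg N) (Reg r)) (Seq (compile c) (Assign r (Plus (Reg r) (Const 1)))))"

text \<open>Since every loop is bounded, this is a total function. The loop variable is reset at the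
  start of each pass and ends with the value of the bound, which is what \<open>compile\<close>
  produces as long as the body changes neither of the two registers, the condition imposed by
  \<open>well_formed\<close>.\<close>

primrec sem :: "lcom \<Rightarrow> state \<Rightarrow> state" where
  "sem LSkip \<sigma> = \<sigma>"
| "sem (LAssign r a) \<sigma> = set_reg r (aval a \<sigma>) \<sigma>"
| "sem (LStore m a b) \<sigma> = set_cell m (aval a \<sigma>) (aval b \<sigma>) \<sigma>"
| "sem (LSeq c d) \<sigma> = sem d (sem c \<sigma>)"
| "sem (LIf a c d) \<sigma> = (if aval a \<sigma> \<noteq> 0 then sem c \<sigma> else sem d \<sigma>)"
| "sem (LFor r N c) \<sigma> =
     set_reg r (regs \<sigma> N) (fold (\<lambda>i \<tau>. sem c (set_reg r i \<tau>)) [0..<regs \<sigma> N] \<sigma>)"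

primrec wr :: "lcom \<Rightarrow> string set" where
  "wr LSkip = {}"
| "wr (LAssign r a) = {r}"
| "wr (LStore m a b) = {}"
| "wr (LSeq c d) = wr c \<union> wr d"
| "wr (LIf a c d) = wr c \<union> wr d"
| "wr (LFor r N c) = insert r (wr c)"

primrec wa :: "lcom \<Rightarrow> string set" where
  "wa LSkip = {}"
| "wa (LAssign r a) = {}"
| "wa (LStore m a b) = {m}"
| "wa (LSeq c d) = wa c \<union> wa d"
| "wa (LIf a c d) = wa c \<union> wa d"
| "wa (LFor r N c) = wa c"

primrec bounds :: "lcom \<Rightarrow> string set" where
  "bounds LSkip = {}"
| "bounds (LAssign r a) = {}"
| "bounds (LStore m a b) = {}"
| "bounds (LSeq c d) = bounds c \<union> bounds d"
| "bounds (LIf a c d) = bounds c \<union> bounds d"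
| "bounds (LFor r N c) = insert N (bounds c)"

primrec well_formed :: "lcom \<Rightarrow> bool" where
  "well_formed LSkip = True"
| "well_formed (LAssign r a) = True"
| "well_formed (LStore m a b) = True"
| "well_formed (LSeq c d) = (well_formed c \<and> well_formed d)"
| "well_formed (LIf a c d) = (well_formed c \<and> well_formed d)"
| "well_formed (LFor r N c) = (r \<noteq> N \<and> r \<notin> wr c \<and> N \<notin> wr c \<and> well_formed c)"

lemma regs_set_reg [simp]: "regs (set_reg r v \<sigma>) = (regs \<sigma>)(r := v)"
  and arrays_set_reg [simp]: "arrays (set_reg r v \<sigma>) = arrays \<sigma>"
  and regs_set_cell [simp]: "regs (set_cell m i v \<sigma>) = regs \<sigma>"
  and arrays_set_cell [simp]: "arrays (set_cell m i v \<sigma>) = (arrays \<sigma>)(m := (arrays \<sigma> m)(i := v))"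
  by (simp_all add: set_reg_def set_cell_def)

lemma sem_regs [simp]: "r \<notin> wr c \<Longrightarrow> regs (sem c \<sigma>) r = regs \<sigma> r"
proof (induction c arbitrary: \<sigma>)
  case (LFor x N c)
  have "regs (fold (\<lambda>i \<tau>. sem c (set_reg x i \<tau>)) [0..<n] \<sigma>) r = regs \<sigma> r" for n
    by (induction n) (use LFor in auto)
  then show ?case using LFor.prems by auto
qed auto

lemma sem_arrays [simp]: "m \<notin> wa c \<Longrightarrow> arrays (sem c \<sigma>) m = arrays \<sigma> m"
proof (induction c arbitrary: \<sigma>)
  case (LFor x N c)
  have "arrays (fold (\<lambda>i \<tau>. sem c (set_reg x i \<tau>)) [0..<n] \<sigma>) m = arrays \<sigma> m" for n
    by (induction n) (use LFor in auto)
  then show ?case using LFor.prems by auto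
qed auto

text \<open>A frame relation for states met inside \<open>c\<close> as well as for its final state;
  the loop rules hand it out, so that invariants list only what the loop changes.\<close>

definition agree :: "lcom \<Rightarrow> state \<Rightarrow> state \<Rightarrow> bool" where
  "agree c \<sigma> \<tau> \<longleftrightarrow> (\<forall>r. r \<notin> wr c \<longrightarrow> regs \<tau> r = regs \<sigma> r) \<and> (\<forall>m. m \<notin> wa c \<longrightarrow> arrays \<tau> m = arrays \<sigma> m)"

lemma agree_refl [simp]: "agree c \<sigma> \<sigma>"
  and agree_sem [simp]: "agree c \<sigma> (sem c \<sigma>)"
  by (simp_all add: agree_def)

lemma agree_trans: "agree c \<sigma> \<tau> \<Longrightarrow> agree c \<tau> \<rho> \<Longrightarrow> agree c \<sigma> \<rho>"
  by (simp add: agree_def)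

lemma agree_mono: "agree c \<sigma> \<tau> \<Longrightarrow> wr c \<subseteq> wr d \<Longrightarrow> wa c \<subseteq> wa d \<Longrightarrow> agree d \<sigma> \<tau>"
  by (auto simp: agree_def)

lemma agree_regs: "agree c \<sigma> \<tau> \<Longrightarrow> r \<notin> wr c \<Longrightarrow> regs \<tau> r = regs \<sigma> r"
  and agree_arrays: "agree c \<sigma> \<tau> \<Longrightarrow> m \<notin> wa c \<Longrightarrow> arrays \<tau> m = arrays \<sigma> m"
  by (auto simp: agree_def)

lemma agree_set_reg: "agree c \<sigma> \<tau> \<Longrightarrow> r \<in> wr c \<Longrightarrow> agree c \<sigma> (set_reg r v \<tau>)"
  by (auto simp: agree_def)

text \<open>The invariant is stated between passes, before the loop variable is set, and comes with
  a frame fact; the last premise covers the value that the loop variable keeps after the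
  loop.\<close>

lemma sem_LFor_induct:
  assumes "P 0 \<sigma>"
    and "\<And>i \<tau>. i < regs \<sigma> N \<Longrightarrow> P i \<tau> \<Longrightarrow> agree (LFor r N c) \<sigma> \<tau> \<Longrightarrow> P (Suc i) (sem c (set_reg r i \<tau>))"
    and "\<And>\<tau>. P (regs \<sigma> N) \<tau> \<Longrightarrow> Q (set_reg r (regs \<sigma> N) \<tau>)"
  shows "Q (sem (LFor r N c) \<sigma>)"
proof -
  let ?f = "\<lambda>k. fold (\<lambda>i \<tau>. sem c (set_reg r i \<tau>)) [0..<k] \<sigma>"
  have "k \<le> regs \<sigma> N \<Longrightarrow> P k (?f k) \<and> agree (LFor r N c) \<sigma> (?f k)" for k
  proof (induction k)
    case (Suc k)
    then have IH: "P k (?f k)" "agree (LFor r N c) \<sigma> (?f k)" by auto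
    from IH(2) have "agree (LFor r N c) \<sigma> (?f (Suc k))"
      by (auto simp: agree_def)
    with assms(2)[OF _ IH] Suc.prems show ?case by simp
  qed (use assms(1) in auto)
  then show ?thesis using assms(3) by simp
qed

text \<open>In the loop clause, 6 pays for the initial assignment (2) and the failing test (4), and
  8 for the test and the increment of each pass. Branches are added rather than compared, so that
  polynomial bounds need only closure under sums.\<close>

primrec time_bound :: "lcom \<Rightarrow> nat \<Rightarrow> nat" where
  "time_bound LSkip M = 1"
| "time_bound (LAssign r a) M = Suc (acost a)"
| "time_bound (LStore m a b) M = Suc (acost a + acost b)"
| "time_bound (LSeq c d) M = time_bound c M + time_bound d M"
| "time_bound (LIf a c d) M = Suc (acost a + (time_bound c M + time_bound d M))"
| "time_bound (LFor r N c) M = 6 + M * (time_bound c M + 8)"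

text \<open>\<open>well_formed\<close> makes the compiled while loops follow \<open>sem\<close>. The
  disjointness of \<open>bounds c\<close> and \<open>wr c\<close> is for the time: every bound keeps
  its initial value, so one number \<open>M\<close> limits the loops at every depth.\<close>

lemma exec_compile:
  assumes "well_formed c" and "bounds c \<inter> wr c = {}" and "\<And>N. N \<in> bounds c \<Longrightarrow> regs \<sigma> N \<le> M"
  shows "\<exists>k \<le> time_bound c M. exec (compile c) \<sigma> k (sem c \<sigma>)"
  using assms
proof (induction c arbitrary: \<sigma>)
  case LSkip
  show ?case using exec_Skip by auto
next
  case (LAssign r a)
  show ?case using exec_Assign by auto
next
  case (LStore m a b)
  show ?case using exec_Store by auto
next
  case (LSeq c d)
  obtain k where k: "k \<le> time_bound c M" "exec (compile c) \<sigma> k (sem c \<sigma>)"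
    using LSeq.IH(1)[of \<sigma>, OF _ _ LSeq.prems(3)] LSeq.prems(1,2) by auto
  have "N \<in> bounds d \<Longrightarrow> regs (sem c \<sigma>) N \<le> M" for N
    using LSeq.prems by (subst sem_regs) auto
  then obtain l where "l \<le> time_bound d M" "exec (compile d) (sem c \<sigma>) l (sem d (sem c \<sigma>))"
    using LSeq.IH(2)[of "sem c \<sigma>"] LSeq.prems(1,2) by auto
  with k show ?case
    by (intro exI[of _ "k + l"]) (simp add: exec_Seq)
next
  case (LIf a c d)
  show ?case
  proof (cases "aval a \<sigma> = 0")
    case True
    obtain k where "k \<le> time_bound d M" "exec (compile d) \<sigma> k (sem d \<sigma>)"
      using LIf.IH(2)[of \<sigma>, OF _ _ LIf.prems(3)] LIf.prems(1,2) by auto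
    with True show ?thesis
      by (intro exI[of _ "Suc (acost a + k)"]) (simp add: exec_If_false)
  next
    case False
    obtain k where "k \<le> time_bound c M" "exec (compile c) \<sigma> k (sem c \<sigma>)"
      using LIf.IH(1)[of \<sigma>, OF _ _ LIf.prems(3)] LIf.prems(1,2) by auto
    with False show ?thesis
      by (intro exI[of _ "Suc (acost a + k)"]) (simp add: exec_If_true)
  qed
next
  case (LFor r N c)
  let ?n = "regs \<sigma> N"
  let ?f = "\<lambda>k. fold (\<lambda>i \<tau>. sem c (set_reg r i \<tau>)) [0..<k] \<sigma>"
  let ?W = "WhileNz (Minus (Reg N) (Reg r)) (Seq (compile c) (Assign r (Plus (Reg r) (Const 1))))"
  have ag: "agree (LFor r N c) \<sigma> (?f k)" for k
    by (induction k) (auto simp: agree_def)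
  \<comment> \<open>\<open>i\<close> counts the passes still to come, because \<open>exec\<close>
    composes a while loop from its last test backwards.\<close>
  have W: "i \<le> ?n \<Longrightarrow> \<exists>k \<le> 4 + i * (time_bound c M + 8).
      exec ?W (set_reg r (?n - i) (?f (?n - i))) k (set_reg r ?n (?f ?n))" for i
  proof (induction i)
    case 0
    have "regs (?f ?n) N = ?n"
      using agree_regs[OF ag] LFor.prems by auto
    then have "aval (Minus (Reg N) (Reg r)) (set_reg r ?n (?f ?n)) = 0"
      by simp
    from exec_While_false[OF this, of "Seq (compile c) (Assign r (Plus (Reg r) (Const 1)))"]
    show ?case by (intro exI[of _ 4]) (auto simp: numeral_eq_Suc)
  next
    case (Suc i)
    let ?j = "?n - Suc i"
    let ?\<tau> = "set_reg r ?j (?f ?j)"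
    have j: "Suc ?j = ?n - i" using Suc.prems by simp
    obtain l where l: "l \<le> 4 + i * (time_bound c M + 8)"
        "exec ?W (set_reg r (?n - i) (?f (?n - i))) l (set_reg r ?n (?f ?n))"
      using Suc by auto
    have "regs ?\<tau> x \<le> M" if "x \<in> bounds c" for x
    proof -
      have "x \<noteq> r" "x \<notin> wr (LFor r N c)" using that LFor.prems(2) by auto
      then show ?thesis using agree_regs[OF ag, of x ?j] LFor.prems(3)[of x] that by simp
    qed
    then obtain k where k: "k \<le> time_bound c M" "exec (compile c) ?\<tau> k (sem c ?\<tau>)"
      using LFor.IH[of ?\<tau>] LFor.prems(1,2) by auto
    have fS: "?f (Suc ?j) = sem c ?\<tau>" by simp
    have "regs (sem c ?\<tau>) r = ?j" using LFor.prems by simp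
    then have "set_reg r (aval (Plus (Reg r) (Const 1)) (sem c ?\<tau>)) (sem c ?\<tau>)
        = set_reg r (?n - i) (?f (?n - i))"
      using j fS by simp
    then have "exec (Assign r (Plus (Reg r) (Const 1))) (sem c ?\<tau>) 4 (set_reg r (?n - i) (?f (?n - i)))"
      using exec_Assign[of r "Plus (Reg r) (Const 1)" "sem c ?\<tau>"] by (simp add: numeral_eq_Suc)
    then have b: "exec (Seq (compile c) (Assign r (Plus (Reg r) (Const 1)))) ?\<tau> (k + 4)
        (set_reg r (?n - i) (?f (?n - i)))"
      using k(2) exec_Seq by blast
    have "regs (?f ?j) N = ?n"
      using agree_regs[OF ag] LFor.prems by auto
    then have "aval (Minus (Reg N) (Reg r)) ?\<tau> \<noteq> 0"
      using LFor.prems Suc.prems by auto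
    from exec_While_true[OF this b l(2)]
    show ?case
      by (intro exI[of _ "Suc (acost (Minus (Reg N) (Reg r)) + (k + 4) + l)"])
        (use k(1) l(1) in simp)
  qed
  from W[of ?n] obtain k where k: "k \<le> 4 + ?n * (time_bound c M + 8)"
    "exec ?W (set_reg r 0 \<sigma>) k (set_reg r ?n (?f ?n))"
    by auto
  have "exec (Assign r (Const 0)) \<sigma> 2 (set_reg r 0 \<sigma>)"
    using exec_Assign[of r "Const 0" \<sigma>] by (simp add: numeral_eq_Suc)
  from exec_Seq[OF this k(2)] have "exec (compile (LFor r N c)) \<sigma> (2 + k) (sem (LFor r N c) \<sigma>)"
    by simp
  moreover have "?n * (time_bound c M + 8) \<le> M * (time_bound c M + 8)"
    using LFor.prems by (intro mult_right_mono) auto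
  then have "2 + k \<le> time_bound (LFor r N c) M"
    using k(1) unfolding time_bound.simps by linarith
  ultimately show ?case by blast
qed

text \<open>Functions with such a bound are closed under addition and under multiplication by
  \<open>M\<close>. The base \<open>Suc M\<close> is at least 1, which lets exponents be raised even
  when \<open>M\<close> is 0.\<close>

lemma time_bound_polynomial: "\<exists>K e. \<forall>M. time_bound c M \<le> K * Suc M ^ e"
proof -
  have add: "\<exists>K e. \<forall>M. f M + g M \<le> K * Suc M ^ e"
    if "\<exists>K e. \<forall>M. f M \<le> K * Suc M ^ e" "\<exists>K e. \<forall>M. g M \<le> K * Suc M ^ e" for f g :: "nat \<Rightarrow> nat"
  proof -
    from that obtain K e K' e' where *: "\<And>M. f M \<le> K * Suc M ^ e" "\<And>M. g M \<le> K' * Suc M ^ e'"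
      by auto
    have "f M + g M \<le> (K + K') * Suc M ^ (e + e')" for M
    proof -
      have "K * Suc M ^ e \<le> K * Suc M ^ (e + e')" "K' * Suc M ^ e' \<le> K' * Suc M ^ (e + e')"
        by (auto intro!: mult_left_mono power_increasing)
      with *[of M] show ?thesis unfolding add_mult_distrib by linarith
    qed
    then show ?thesis by blast
  qed
  have const: "\<exists>K e. \<forall>M. k \<le> K * Suc M ^ e" for k :: nat
    by (rule exI[of _ k], rule exI[of _ 0]) simp
  show ?thesis
  proof (induction c)
    case (LSeq c d)
    then show ?case by (simp add: add)
  next
    case (LIf a c d)
    show ?case using add[OF const[of "Suc (acost a)"] add[OF LIf.IH]] by (simp add: add.assoc)
  next
    case (LFor r N c)
    obtain K e where Ke: "\<And>M. time_bound c M + 8 \<le> K * Suc M ^ e"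
      using add[OF LFor const[of 8]] by blast
    have "M * (time_bound c M + 8) \<le> K * Suc M ^ (Suc e)" for M
    proof -
      have "M * (time_bound c M + 8) \<le> Suc M * (K * Suc M ^ e)"
        by (intro mult_mono Ke) auto
      then show ?thesis by (simp add: algebra_simps)
    qed
    then have "\<exists>K e. \<forall>M. M * (time_bound c M + 8) \<le> K * Suc M ^ e" by blast
    from add[OF const[of 6] this] show ?case by simp
  qed (simp_all only: time_bound.simps const)
qed

section \<open>Loop nests and guarded commands\<close>

primrec nest :: "(string \<times> string) list \<Rightarrow> lcom \<Rightarrow> lcom" where
  "nest [] c = c"
| "nest (x # xs) c = LFor (fst x) (snd x) (nest xs c)"

primrec guard :: "aexp list \<Rightarrow> lcom \<Rightarrow> lcom" where
  "guard [] c = c"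
| "guard (a # as) c = LIf a (guard as c) LSkip"

lemma sem_guard [simp]: "sem (guard as c) \<sigma> = (if \<forall>a\<in>set as. aval a \<sigma> \<noteq> 0 then sem c \<sigma> else \<sigma>)"
  by (induction as) auto

lemma guard_simps [simp]:
  "wr (guard as c) = wr c" "wa (guard as c) = wa c" "bounds (guard as c) = bounds c" "well_formed (guard as c) = well_formed c"
  by (induction as) auto

lemma nest_simps [simp]:
  "wr (nest xs c) = fst ` set xs \<union> wr c" "wa (nest xs c) = wa c"
  "bounds (nest xs c) = snd ` set xs \<union> bounds c"
  by (induction xs) auto

text \<open>If \<open>R\<close> is a preorder respected by all steps of a loop nest, then every tuple of values of
  the loop variables is met by an execution of the body that lies on the \<open>R\<close>-chain from the initial
  to the final state.\<close>

lemma sem_nest: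
  assumes "well_formed (nest xs c)" "bounds (nest xs c) \<inter> wr (nest xs c) = {}"
    and refl: "\<And>\<tau>. R \<tau> \<tau>" and trans: "\<And>\<tau> \<tau>' \<tau>''. R \<tau> \<tau>' \<Longrightarrow> R \<tau>' \<tau>'' \<Longrightarrow> R \<tau> \<tau>''"
    and regs: "\<And>\<tau> r v. r \<in> fst ` set xs \<Longrightarrow> R \<tau> (set_reg r v \<tau>)"
    and body: "\<And>\<tau>. agree (nest xs c) \<sigma> \<tau> \<Longrightarrow> (\<And>r N. (r, N) \<in> set xs \<Longrightarrow> regs \<tau> r < regs \<sigma> N) \<Longrightarrow> R \<tau> (sem c \<tau>)"
  shows "R \<sigma> (sem (nest xs c) \<sigma>) \<and>
    (\<forall>vs. list_all2 (\<lambda>v x. v < regs \<sigma> (snd x)) vs xs \<longrightarrow>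
      (\<exists>\<tau>. agree (nest xs c) \<sigma> \<tau> \<and> R \<sigma> \<tau> \<and> R (sem c \<tau>) (sem (nest xs c) \<sigma>) \<and> map (regs \<tau> \<circ> fst) xs = vs))"
  using assms(1,2,5,6)
proof (induction xs arbitrary: \<sigma>)
  case Nil
  then have "R \<sigma> (sem c \<sigma>)" by simp
  then show ?case using refl by (auto intro!: exI[of _ \<sigma>])
next
  case (Cons x xs)
  obtain r N where x: "x = (r, N)" by (cases x)
  let ?d = "nest xs c" and ?c = "nest (x # xs) c"
  have r: "r \<notin> wr ?d" "N \<notin> wr ?d" using Cons.prems(1) x by auto
  have IH: "R \<tau> (sem ?d \<tau>) \<and> (\<forall>vs. list_all2 (\<lambda>v x. v < regs \<tau> (snd x)) vs xs \<longrightarrow>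
      (\<exists>\<rho>. agree ?d \<tau> \<rho> \<and> R \<tau> \<rho> \<and> R (sem c \<rho>) (sem ?d \<tau>) \<and> map (regs \<rho> \<circ> fst) xs = vs))"
    if \<tau>: "agree ?c \<sigma> \<tau>" "regs \<tau> r < regs \<sigma> N" for \<tau>
  proof (rule Cons.IH)
    show "well_formed ?d" "bounds ?d \<inter> wr ?d = {}" using Cons.prems(1,2) by auto
    show "\<And>\<tau> r v. r \<in> fst ` set xs \<Longrightarrow> R \<tau> (set_reg r v \<tau>)" using Cons.prems(3) by auto
    fix \<rho> assume \<rho>: "agree ?d \<tau> \<rho>" "\<And>r N. (r, N) \<in> set xs \<Longrightarrow> regs \<rho> r < regs \<tau> N"
    have "agree ?c \<tau> \<rho>" using \<rho>(1) by (rule agree_mono) auto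
    with \<tau>(1) have ag: "agree ?c \<sigma> \<rho>" by (rule agree_trans)
    show "R \<rho> (sem c \<rho>)"
    proof (rule Cons.prems(4)[OF ag])
      fix r' N' assume A: "(r', N') \<in> set (x # xs)"
      show "regs \<rho> r' < regs \<sigma> N'"
      proof (cases "(r', N') = x")
        case True
        then show ?thesis using x \<tau>(2) agree_regs[OF \<rho>(1) r(1)] by simp
      next
        case False
        with A have A': "(r', N') \<in> set xs" by auto
        then have "N' \<in> snd ` set xs" by (metis imageI snd_conv)
        then have "N' \<in> bounds ?c" by simp
        then have "N' \<notin> wr ?c" using Cons.prems(2) by blast
        then have "regs \<tau> N' = regs \<sigma> N'" using agree_regs[OF \<tau>(1)] by blast
        with \<rho>(2)[OF A'] show ?thesis by simp
      qed
    qed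
  qed
  let ?f = "\<lambda>k. fold (\<lambda>i \<tau>. sem ?d (set_reg r i \<tau>)) [0..<k] \<sigma>"
  have setr: "R \<tau> (set_reg r v \<tau>)" for \<tau> v using Cons.prems(3) x by simp
  have ag: "agree ?c \<sigma> (?f k)" for k
  proof (induction k)
    case (Suc k)
    then have "agree ?c \<sigma> (set_reg r k (?f k))" by (rule agree_set_reg) (simp add: x)
    then have "agree ?c \<sigma> (sem ?d (set_reg r k (?f k)))"
      using agree_mono[OF agree_sem, of ?d ?c] by (rule agree_trans) auto
    then show ?case by simp
  qed simp
  have ag': "agree ?c \<sigma> (set_reg r v (?f k))" for k v
    using ag by (rule agree_set_reg) (simp add: x)
  have R_step: "R (?f k) (?f (Suc k))" if "k < regs \<sigma> N" for k
  proof -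
    have "R (set_reg r k (?f k)) (sem ?d (set_reg r k (?f k)))"
      using IH[OF ag'[of k k]] that by (simp only: regs_set_reg fun_upd_same)
    from trans[OF setr this] show ?thesis by simp
  qed
  have chain: "k \<le> l \<Longrightarrow> l \<le> regs \<sigma> N \<Longrightarrow> R (?f k) (?f l)" for k l
  proof (induction l rule: dec_induct)
    case base
    show ?case by (rule refl)
  next
    case (step l)
    have "R (?f l) (?f (Suc l))" by (rule R_step) (use step.prems in simp)
    moreover have "R (?f k) (?f l)" using step.IH step.prems by simp
    ultimately show ?case using trans by blast
  qed
  have fin: "sem ?c \<sigma> = set_reg r (regs \<sigma> N) (?f (regs \<sigma> N))" by (simp add: x)
  have end_R: "R (?f k) (sem ?c \<sigma>)" if "k \<le> regs \<sigma> N" for k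
    unfolding fin using trans[OF chain[OF that order.refl] setr] .
  show ?case
  proof (intro conjI allI impI)
    show "R \<sigma> (sem ?c \<sigma>)" using end_R[of 0] by simp
    fix vs assume vs: "list_all2 (\<lambda>v x. v < regs \<sigma> (snd x)) vs (x # xs)"
    then obtain v ws where vws: "vs = v # ws" "v < regs \<sigma> N" "list_all2 (\<lambda>v x. v < regs \<sigma> (snd x)) ws xs"
      by (auto simp: list_all2_Cons2 x)
    \<comment> \<open>The state just before the inner run of pass \<open>v\<close>, to which the
      induction hypothesis is applied; that run ends in \<open>?f (Suc v)\<close>.\<close>
    let ?\<tau> = "set_reg r v (?f v)"
    have "regs ?\<tau> (snd y) = regs \<sigma> (snd y)" if "y \<in> set xs" for y
    proof -
      have "snd y \<in> bounds ?c" using that by simp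
      then show ?thesis using agree_regs[OF ag'] Cons.prems(2) by blast
    qed
    with vws(3) have "list_all2 (\<lambda>v x. v < regs ?\<tau> (snd x)) ws xs"
      by (auto simp: list_all2_conv_all_nth)
    then obtain \<rho> where \<rho>: "agree ?d ?\<tau> \<rho>" "R ?\<tau> \<rho>" "R (sem c \<rho>) (sem ?d ?\<tau>)"
        "map (regs \<rho> \<circ> fst) xs = ws"
      using mp[OF spec[OF conjunct2[OF IH[OF ag'[of v v]]]]] vws(2) by auto
    have "regs \<rho> r = v" using agree_regs[OF \<rho>(1) r(1)] by simp
    moreover have "agree ?c \<sigma> \<rho>"
      using ag' agree_mono[OF \<rho>(1), of ?c] by (rule agree_trans) auto
    moreover have "R \<sigma> \<rho>"
      using trans[OF trans[OF chain[of 0 v] setr[of _ v]] \<rho>(2)] vws(2) by simp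
    moreover have "R (sem c \<rho>) (sem ?c \<sigma>)"
      using trans[OF \<rho>(3)] end_R[of "Suc v"] vws(2) by simp
    ultimately show "\<exists>\<tau>. agree ?c \<sigma> \<tau> \<and> R \<sigma> \<tau> \<and> R (sem c \<tau>) (sem ?c \<sigma>) \<and> map (regs \<tau> \<circ> fst) (x # xs) = vs"
      using \<rho>(4) vws(1) x by (intro exI[of _ \<rho>]) auto
  qed
qed

section \<open>Token sliding and matchings\<close>

text \<open>Vertex functions mediate between the arc lists of the graph library and relation powers,
  the latter through \<open>relpow_fun_conv\<close>.\<close>

definition walk_seq :: "('a \<times> 'a) set \<Rightarrow> 'a \<Rightarrow> 'a \<Rightarrow> nat \<Rightarrow> (nat \<Rightarrow> 'a) \<Rightarrow> bool" where
  "walk_seq R s t d f \<longleftrightarrow> f 0 = s \<and> f d = t \<and> (\<forall>i<d. (f i, f (Suc i)) \<in> R)"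

lemma walk_seq_relpow: "walk_seq R s t d f \<Longrightarrow> (s, t) \<in> R ^^ d"
  unfolding walk_seq_def relpow_fun_conv by blast

lemma walk_seq_prefix: "walk_seq R s t d f \<Longrightarrow> i \<le> d \<Longrightarrow> (s, f i) \<in> R ^^ i"
  unfolding walk_seq_def relpow_fun_conv by (intro exI[of _ f]) auto

lemma walk_seq_suffix:
  assumes "walk_seq R s t d f" "i \<le> d"
  shows "(f i, t) \<in> R ^^ (d - i)"
  unfolding relpow_fun_conv using assms
  by (intro exI[of _ "\<lambda>k. f (i + k)"]) (auto simp: walk_seq_def)

lemma relpow_sym: "sym R \<Longrightarrow> (x, y) \<in> R ^^ k \<Longrightarrow> (y, x) \<in> R ^^ k"
proof (induction k arbitrary: x y)
  case (Suc k)
  then obtain z where "(x, z) \<in> R ^^ k" "(z, y) \<in> R" by auto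
  with Suc have "(y, z) \<in> R" "(z, x) \<in> R ^^ k" by (auto dest: symD)
  then show ?case by (rule relpow_Suc_I2)
qed simp

lemma relpow_comp: "(x, y) \<in> R ^^ k \<Longrightarrow> (y, z) \<in> R ^^ l \<Longrightarrow> (x, z) \<in> R ^^ (k + l)"
  unfolding relpow_add by blast

lemma map_upt_Suc0: "map g [0..<Suc k] = g 0 # map (\<lambda>i. g (Suc i)) [0..<k]"
  by (subst upt_conv_Cons) (simp_all flip: map_Suc_upt add: comp_def del: upt_Suc)

section \<open>Shortest paths as walks of minimum length\<close>

context pair_wf_digraph
begin

lemma awalk_walk_seq:
  "awalk u p v \<Longrightarrow> \<exists>f. walk_seq (parcs G) u v (length p) f \<and> pawalk_verts u p = map f [0..<Suc (length p)]"
proof (induction p arbitrary: u)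
  case Nil
  then show ?case by (intro exI[of _ "\<lambda>_. u"]) (auto simp: walk_seq_def awalk_Nil_iff)
next
  case (Cons e p)
  obtain w where e: "e = (u, w)" "(u, w) \<in> parcs G" and p: "awalk w p v"
    using Cons.prems by (cases e) (auto simp: awalk_Cons_iff)
  obtain f where f: "walk_seq (parcs G) w v (length p) f" "pawalk_verts w p = map f [0..<Suc (length p)]"
    using Cons.IH[OF p] by auto
  let ?f = "case_nat u f"
  have "walk_seq (parcs G) u v (Suc (length p)) ?f"
    using f(1) e(2) by (auto simp: walk_seq_def less_Suc_eq_0_disj)
  moreover have "map ?f [0..<Suc (Suc (length p))] = u # map f [0..<Suc (length p)]"
    by (subst map_upt_Suc0) simp
  ultimately show ?case using f(2) e(1) by (intro exI[of _ ?f]) (simp del: upt_Suc)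
qed

lemma walk_seq_awalk:
  assumes "walk_seq (parcs G) u v d f" "u \<in> pverts G"
  shows "awalk u (map (\<lambda>i. (f i, f (Suc i))) [0..<d]) v \<and>
    pawalk_verts u (map (\<lambda>i. (f i, f (Suc i))) [0..<d]) = map f [0..<Suc d]"
  using assms
proof (induction d arbitrary: u f)
  case 0
  then have "u = v" "f 0 = u" "u \<in> pverts G" by (auto simp: walk_seq_def)
  then show ?case by (simp add: awalk_Nil_iff)
next
  case (Suc d)
  have f: "f 0 = u" "(u, f 1) \<in> parcs G" using Suc.prems by (auto simp: walk_seq_def)
  then have "f 1 \<in> pverts G" by (auto dest: in_arcsD2)
  moreover have "walk_seq (parcs G) (f 1) v d (\<lambda>i. f (Suc i))"
    using Suc.prems by (auto simp: walk_seq_def)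
  ultimately have "awalk (f 1) (map (\<lambda>i. (f (Suc i), f (Suc (Suc i)))) [0..<d]) v \<and>
    pawalk_verts (f 1) (map (\<lambda>i. (f (Suc i), f (Suc (Suc i)))) [0..<d]) = map (\<lambda>i. f (Suc i)) [0..<Suc d]"
    by (intro Suc.IH)
  then show ?case
    unfolding map_upt_Suc0[of _ d] map_upt_Suc0[of _ "Suc d"] using f Suc.prems
    by (simp add: awalk_Cons_iff del: upt_Suc)
qed

text \<open>A removed cycle contains an arc, so its removal shortens the walk. Hence a walk of
  minimum length has distinct vertices, and minimality among \<open>apath\<close>s is minimality
  among all walks.\<close>

lemma awalk_shortcut:
  assumes "awalk u p v"
  shows "\<exists>q. apath u q v \<and> length q \<le> length p \<and> (distinct (pawalk_verts u p) \<or> length q < length p)"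
  using assms
proof (induction rule: awalk_to_apath_induct)
  case (path p)
  then show ?case by (auto simp: apath_def)
next
  case (decomp p q r s)
  then have "p = q @ r @ s" "0 < length r"
    using awalk_cyc_decomp_has_prop[of u p v] by auto
  then have "length (q @ s) < length p" by simp
  with decomp(4) show ?case by (meson le_less_trans less_imp_le)
qed

end

lemma shortest_pathD:
  assumes "pair_graph G" "shortest_path G s p t"
  shows "\<exists>f. walk_seq (parcs G) s t (length p) f \<and> path_vertices s p = f ` {..length p} \<and>
    (\<forall>k<length p. (s, t) \<notin> parcs G ^^ k) \<and> card (path_vertices s p) = Suc (length p)"
proof -
  interpret pair_graph G by fact
  have p: "apath s p t" "\<And>q. apath s q t \<Longrightarrow> length p \<le> length q"
    using assms(2) by (auto simp: shortest_path_def)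
  then have aw: "awalk s p t" "distinct (pawalk_verts s p)" by (auto simp: apath_def)
  then obtain f where f: "walk_seq (parcs G) s t (length p) f" "pawalk_verts s p = map f [0..<Suc (length p)]"
    using awalk_walk_seq by blast
  have 1: "path_vertices s p = f ` {..length p}"
    unfolding path_vertices_def f(2) set_map by (simp only: set_upt atLeast0_lessThan_Suc_eq_insert_0 atLeast0LessThan lessThan_Suc_atMost)
  have 2: "(s, t) \<notin> parcs G ^^ k" if "k < length p" for k
  proof
    assume "(s, t) \<in> parcs G ^^ k"
    then obtain g where "walk_seq (parcs G) s t k g" unfolding walk_seq_def relpow_fun_conv by auto
    moreover have "s \<in> pverts G" using aw(1) by (auto simp: awalk_def)
    ultimately obtain q where "awalk s q t" "length q = k"
      using walk_seq_awalk by fastforce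
    with awalk_shortcut p(2) that show False by fastforce
  qed
  have 3: "card (path_vertices s p) = Suc (length p)"
    unfolding path_vertices_def distinct_card[OF aw(2)] unfolding f(2) by simp
  from f(1) 1 2 3 show ?thesis by blast
qed

text \<open>Distinctness of the vertices comes from minimality: a repetition could be cut out,
  leaving a path with fewer than \<open>d\<close> arcs.\<close>

lemma shortest_pathI:
  assumes "pair_graph G" "s \<in> pverts G" "walk_seq (parcs G) s t d f"
    and "\<And>k. k < d \<Longrightarrow> (s, t) \<notin> parcs G ^^ k"
  shows "\<exists>p. shortest_path G s p t \<and> path_vertices s p = f ` {..d}"
proof -
  interpret pair_graph G by fact
  let ?p = "map (\<lambda>i. (f i, f (Suc i))) [0..<d]"
  have p: "awalk s ?p t" "pawalk_verts s ?p = map f [0..<Suc d]"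
    using walk_seq_awalk[OF assms(3,2)] by auto
  have min: "d \<le> length q" if "apath s q t" for q
  proof -
    from that have "awalk s q t" by (simp add: apath_def)
    then obtain g where "walk_seq (parcs G) s t (length q) g" using awalk_walk_seq by blast
    then have "(s, t) \<in> parcs G ^^ length q" by (rule walk_seq_relpow)
    then show ?thesis using assms(4) not_less by blast
  qed
  from awalk_shortcut[OF p(1)] min have "distinct (pawalk_verts s ?p)"
    by fastforce
  with p(1) have "apath s ?p t" by (simp add: apath_def)
  then have "shortest_path G s ?p t" using min by (simp add: shortest_path_def)
  moreover have "path_vertices s ?p = f ` {..d}"
    unfolding path_vertices_def p(2) set_map by (simp only: set_upt atLeast0LessThan lessThan_Suc_atMost)
  ultimately show ?thesis by blast
qed

text \<open>The walks need not be shortest.\<close>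

definition cheap_matching :: "('a \<times> 'a) set \<Rightarrow> 'a set \<Rightarrow> 'a set \<Rightarrow> nat \<Rightarrow> bool" where
  "cheap_matching R S P m \<longleftrightarrow>
     (\<exists>g w. bij_betw g S P \<and> (\<forall>u\<in>S. (u, g u) \<in> R ^^ w u) \<and> sum w S \<le> m)"

text \<open>Each token is followed from its start: a slide from \<open>y\<close> to \<open>x\<close>
  appends one arc to the walk of the token now on \<open>y\<close> and leaves the others alone, so
  \<open>l\<close> slides give total length at most \<open>l\<close>.\<close>

lemma discovery_imp_cheap_matching:
  assumes "discovery_sequence G C l" "sym (parcs G)" "finite (C 0)"
  shows "cheap_matching (parcs G) (C 0) (C l) l"
  using assms(1)
proof (induction l)
  case 0
  show ?case unfolding cheap_matching_def
    by (rule exI[of _ id], rule exI[of _ "\<lambda>_. 0"]) auto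
next
  case (Suc l)
  then have "discovery_sequence G C l" by (auto simp: discovery_sequence_def)
  from Suc.IH[OF this] obtain g w where g: "bij_betw g (C 0) (C l)"
    "\<And>u. u \<in> C 0 \<Longrightarrow> (u, g u) \<in> parcs G ^^ w u" "sum w (C 0) \<le> l"
    by (auto simp: cheap_matching_def)
  have "sliding_step G (C l) (C (Suc l))" using Suc.prems by (auto simp: discovery_sequence_def)
  then obtain x y where xy: "y \<in> C l" "x \<notin> C l" "(x, y) \<in> parcs G" "C (Suc l) = (C l - {y}) \<union> {x}"
    by (auto simp: sliding_step_def)
  obtain u where u: "u \<in> C 0" "g u = y" using g(1) xy(1) by (metis bij_betw_imp_surj_on imageE)
  let ?h = "\<lambda>z. if z = y then x else z" and ?w = "w(u := Suc (w u))"
  have "bij_betw ?h (C l) (C (Suc l))"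
    using xy by (auto simp: bij_betw_def inj_on_def)
  then have "bij_betw (?h \<circ> g) (C 0) (C (Suc l))" using g(1) bij_betw_trans by blast
  moreover have "(v, (?h \<circ> g) v) \<in> parcs G ^^ ?w v" if v: "v \<in> C 0" for v
  proof (cases "v = u")
    case True
    have "(y, x) \<in> parcs G" using xy(3) assms(2) by (auto dest: symD)
    then show ?thesis using g(2)[OF u(1)] u(2) True by auto
  next
    case False
    then have "g v \<noteq> y" using u v g(1) by (auto simp: bij_betw_def inj_on_def)
    then show ?thesis using False g(2)[OF v] by simp
  qed
  moreover have "sum ?w (C 0) = Suc (sum w (C 0))"
    using assms(3) u(1) by (simp add: sum.remove[of _ u])
  ultimately show ?case using g(3) unfolding cheap_matching_def
    by (intro exI[of _ "?h \<circ> g"] exI[of _ ?w]) auto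
qed

text \<open>As long as \<open>S \<noteq> P\<close>, some \<open>y \<in> P - S\<close> is missing. On the walk leading to \<open>y\<close>, the last vertex
  carrying a token has a free successor; that token slides and takes over the target \<open>y\<close>, while the
  token matched to \<open>y\<close> inherits its target. The cost of the matching drops by at least one.\<close>

lemma cheap_matching_imp_discovery:
  assumes "cheap_matching (parcs G) S P m" "sym (parcs G)" "S \<subseteq> pverts G" "finite S"
    and "pair_wf_digraph G"
  shows "\<exists>C l. discovery_sequence G C l \<and> C 0 = S \<and> C l = P \<and> l \<le> m"
  using assms(1,3,4)
proof (induction m arbitrary: S)
  case (0 S)
  then obtain g w where "bij_betw g S P" "\<And>u. u \<in> S \<Longrightarrow> (u, g u) \<in> parcs G ^^ w u" "sum w S = 0"
    by (auto simp: cheap_matching_def)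
  then have "\<And>u. u \<in> S \<Longrightarrow> g u = u" using 0 by fastforce
  with \<open>bij_betw g S P\<close> have "S = P" by (auto simp: bij_betw_def)
  then show ?case using 0 by (intro exI[of _ "\<lambda>_. S"] exI[of _ 0]) (auto simp: discovery_sequence_def)
next
  case (Suc m S)
  obtain g w where g: "bij_betw g S P" "\<And>u. u \<in> S \<Longrightarrow> (u, g u) \<in> parcs G ^^ w u" "sum w S \<le> Suc m"
    using Suc.prems(1) by (auto simp: cheap_matching_def)
  show ?case
  proof (cases "S = P")
    case True
    then show ?thesis
      using Suc.prems by (intro exI[of _ "\<lambda>_. S"] exI[of _ 0]) (auto simp: discovery_sequence_def)
  next
    case False
    have "card S = card P" "finite P" using g(1) Suc.prems(3) bij_betw_same_card bij_betw_finite by blast+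
    then have "\<not> P \<subseteq> S" using False Suc.prems(3) card_subset_eq by metis
    then obtain y u where u: "u \<in> S" "g u = y" "y \<notin> S" using g(1) by (auto simp: bij_betw_def)
    obtain f where f: "walk_seq (parcs G) u y (w u) f"
      using g(2)[OF u(1)] u(2) unfolding walk_seq_def relpow_fun_conv by auto
    define j where "j = Max {i. i \<le> w u \<and> f i \<in> S}"
    have "0 \<in> {i. i \<le> w u \<and> f i \<in> S}" using f u(1) by (auto simp: walk_seq_def)
    then have "j \<in> {i. i \<le> w u \<and> f i \<in> S}" unfolding j_def by (intro Max_in) auto
    moreover have "f (w u) \<notin> S" using f u(3) by (simp add: walk_seq_def)
    ultimately have j: "j < w u" "f j \<in> S" by (auto simp: order.order_iff_strict)
    have "f (Suc j) \<notin> S"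
    proof
      assume "f (Suc j) \<in> S"
      then have "Suc j \<le> j" unfolding j_def using j(1)
        by (intro Max_ge) (auto simp: j_def[symmetric])
      then show False by simp
    qed
    define z x where "z = f j" and "x = f (Suc j)"
    have zx: "z \<in> S" "x \<notin> S" "(z, x) \<in> parcs G"
      using j f \<open>f (Suc j) \<notin> S\<close> by (auto simp: z_def x_def walk_seq_def)
    define S' where "S' = (S - {z}) \<union> {x}"
    have uz: "(u, z) \<in> parcs G ^^ j" using walk_seq_prefix[OF f] j by (simp add: z_def)
    have xy: "(x, y) \<in> parcs G ^^ (w u - Suc j)" using walk_seq_suffix[OF f, of "Suc j"] j by (simp add: x_def)
    \<comment> \<open>The walk of \<open>u\<close> is cut around the arc \<open>(z, x)\<close>:
      \<open>x\<close> keeps the remaining \<open>w u - Suc j\<close> steps to \<open>y\<close>, and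
      \<open>u\<close> takes the first \<open>j\<close> steps to \<open>z\<close> followed by the
      walk of \<open>z\<close>. If \<open>u = z\<close>, the second case is void on
      \<open>S'\<close>, since \<open>z\<close> has left.\<close>
    define g' where "g' v = (if v = x then y else if v = u then g z else g v)" for v
    define w' where "w' v = (if v = x then w u - Suc j else if v = u then j + w z else w v)" for v
    have ux: "u \<noteq> x" using u(1) zx(2) by auto
    \<comment> \<open>\<open>h\<close> relabels \<open>S'\<close> as \<open>S\<close> with
      \<open>g' = g \<circ> h\<close>, and \<open>k\<close> inverts it; so \<open>g'\<close> is
      bijective without comparing its values case by case.\<close>
    define h k where "h v = (if v = x then u else if v = u then z else v)"
      and "k v = (if v = u then x else if v = z then u else v)" for v
    have "bij_betw h S' S"
    proof (rule bij_betw_byWitness)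
      show "\<forall>v\<in>S'. k (h v) = v" "\<forall>v\<in>S. h (k v) = v"
        using ux zx(2) by (auto simp: h_def k_def S'_def)
      show "h ` S' \<subseteq> S" "k ` S \<subseteq> S'"
        using ux zx u(1) by (auto simp: h_def k_def S'_def)
    qed
    then have "bij_betw (g \<circ> h) S' P" using g(1) by (rule bij_betw_trans)
    moreover have "g \<circ> h = g'" using u(2) by (auto simp: g'_def h_def)
    ultimately have "bij_betw g' S' P" by simp
    moreover have "(v, g' v) \<in> parcs G ^^ w' v" if "v \<in> S'" for v
      using that g(2) xy relpow_comp[OF uz g(2)[OF zx(1)]] by (auto simp: g'_def w'_def S'_def)
    moreover have "sum w' S' \<le> m"
    proof -
      have fin: "finite (S - {z})" using Suc.prems(3) by simp
      have S': "sum w' S' = (w u - Suc j) + sum w' (S - {z})"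
        unfolding S'_def using fin zx(2) by (simp add: w'_def)
      have S: "sum w S = w z + sum w (S - {z})"
        using Suc.prems(3) zx(1) by (simp add: sum.remove)
      \<comment> \<open>If \<open>u = z\<close>, one walk loses its first \<open>Suc j\<close>
        steps. Otherwise the two changed walks cost \<open>(w u - Suc j) + (j + w z)\<close>, one
        less than before.\<close>
      have "w u - Suc j + sum w' (S - {z}) < w z + sum w (S - {z})"
      proof (cases "u = z")
        case True
        then have "sum w' (S - {z}) = sum w (S - {z})"
          using zx(2) by (intro sum.cong) (auto simp: w'_def)
        then show ?thesis using True j by simp
      next
        case False
        then have "u \<in> S - {z}" using u by simp
        then have "sum w' (S - {z}) = w' u + sum w' (S - {z} - {u})"
          "sum w (S - {z}) = w u + sum w (S - {z} - {u})"
          using fin by (auto simp: sum.remove)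
        moreover have "sum w' (S - {z} - {u}) = sum w (S - {z} - {u})"
          using zx(2) by (intro sum.cong) (auto simp: w'_def)
        moreover have "w' u = j + w z" using ux by (simp add: w'_def)
        ultimately show ?thesis using j by simp
      qed
      then show ?thesis using S S' g(3) by simp
    qed
    ultimately have "cheap_matching (parcs G) S' P m" unfolding cheap_matching_def by blast
    moreover have "x \<in> pverts G" using zx(3) assms(5) pair_wf_digraph.in_arcsD2 by fastforce
    then have "S' \<subseteq> pverts G" "finite S'" using Suc.prems by (auto simp: S'_def)
    ultimately obtain C l where C: "discovery_sequence G C l" "C 0 = S'" "C l = P" "l \<le> m"
      using Suc.IH by blast
    have "sliding_step G S S'"
      unfolding sliding_step_def S'_def using zx assms(2) by (auto dest: symD)
    with C have "discovery_sequence G (case_nat S C) (Suc l)"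
      using Suc.prems(2) by (auto simp: discovery_sequence_def split: nat.split)
    then show ?thesis using C by (intro exI[of _ "case_nat S C"] exI[of _ "Suc l"]) auto
  qed
qed

text \<open>Everything ordered before \<open>\<pi> i\<close> has label at most \<open>i + b\<close>, so it is the image of an index at most \<open>i + 2b\<close>;
  symmetrically from above.\<close>

lemma banded_bijection:
  fixes \<pi> lev :: "nat \<Rightarrow> nat"
  assumes bij: "bij_betw \<pi> {..d} {..d}"
    and mono: "\<And>i j. i \<le> j \<Longrightarrow> j \<le> d \<Longrightarrow> lev i \<le> lev j"
    and near: "\<And>i. i \<le> d \<Longrightarrow> lev (\<pi> i) \<le> i + b \<and> i \<le> lev (\<pi> i) + b"
    and i: "i \<le> d"
  shows "\<pi> i \<le> i + 2 * b \<and> i \<le> \<pi> i + 2 * b"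
proof
  let ?\<rho> = "inv_into {..d} \<pi>"
  have \<rho>: "bij_betw ?\<rho> {..d} {..d}" using bij by (rule bij_betw_inv_into)
  have \<pi>\<rho>: "\<pi> (?\<rho> j) = j" and \<rho>d: "?\<rho> j \<le> d" if "j \<le> d" for j
    using bij_betw_inv_into_right[OF bij, of j] bij_betwE[OF \<rho>] that by auto
  have \<pi>d: "\<pi> i \<le> d" using bij_betwE[OF bij] i by auto
  have "?\<rho> ` {..\<pi> i} \<subseteq> {..i + 2 * b}"
  proof
    fix k assume "k \<in> ?\<rho> ` {..\<pi> i}"
    then obtain j where j: "k = ?\<rho> j" "j \<le> \<pi> i" by auto
    have "lev j \<le> i + b" using mono[OF j(2) \<pi>d] near[OF i] by simp
    then show "k \<in> {..i + 2 * b}" using near[OF \<rho>d, of j] \<pi>\<rho>[of j] j \<pi>d by simp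
  qed
  moreover have "inj_on ?\<rho> {..\<pi> i}"
    using bij_betw_imp_inj_on[OF \<rho>] by (rule inj_on_subset) (use \<pi>d in auto)
  ultimately have "card {..\<pi> i} \<le> card {..i + 2 * b}" by (meson card_inj_on_le finite_atMost)
  then show "\<pi> i \<le> i + 2 * b" by simp
  have "?\<rho> ` {\<pi> i..d} \<subseteq> {i - 2 * b..d}"
  proof
    fix k assume "k \<in> ?\<rho> ` {\<pi> i..d}"
    then obtain j where j: "k = ?\<rho> j" "\<pi> i \<le> j" "j \<le> d" by auto
    have "i \<le> lev j + b" using mono[OF j(2,3)] near[OF i] by simp
    then have "i \<le> ?\<rho> j + 2 * b" using near[OF \<rho>d, of j] \<pi>\<rho>[of j] j by simp
    then show "k \<in> {i - 2 * b..d}" using \<rho>d[of j] j by auto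
  qed
  moreover have "inj_on ?\<rho> {\<pi> i..d}"
    using bij_betw_imp_inj_on[OF \<rho>] by (rule inj_on_subset) auto
  ultimately have "card {\<pi> i..d} \<le> card {i - 2 * b..d}" by (meson card_inj_on_le finite_atLeastAtMost)
  then show "i \<le> \<pi> i + 2 * b" using \<pi>d i by simp
qed

section \<open>Dynamic programming along a shortest path\<close>

text \<open>The bit is free, so no carry occurs; this is how a machine that has only addition sets a
  bit.\<close>

lemma bit_add_power: "\<not> bit m j \<Longrightarrow> bit (m + 2 ^ j) k \<longleftrightarrow> bit m k \<or> k = j" for m :: nat
proof -
  assume "\<not> bit m j"
  then have "m + 2 ^ j = set_bit j m" by (simp add: set_bit_eq)
  then show ?thesis by (auto simp: bit_set_bit_iff)
qed

lemma shifted_mask_less: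
  fixes m :: nat
  assumes "m < 2 ^ Suc a" "j < Suc a"
  shows "(m + 2 ^ j) div 2 < 2 ^ Suc a"
proof -
  have "2 ^ j \<le> (2 :: nat) ^ a" using assms(2) by (intro power_increasing) auto
  then have "m + 2 ^ j < 2 ^ Suc a * 2" using assms(1) unfolding power_Suc by linarith
  then show ?thesis by (rule less_mult_imp_div_less)
qed

locale token_dp =
  fixes R :: "('a \<times> 'a) set" and s t :: 'a and b :: nat and xs :: "'a list"
begin

text \<open>Bit \<open>j\<close> of the mask in a state with path vertex number \<open>i\<close> stands for token number \<open>i + j - 2b\<close>;
  the conjunct \<open>2 * b \<le> i + j\<close> guards the truncated subtraction.\<close>

definition assign :: "nat \<Rightarrow> 'a \<Rightarrow> nat \<Rightarrow> nat \<Rightarrow> nat \<Rightarrow> nat \<Rightarrow> bool" where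
  "assign i v m c j k \<longleftrightarrow> j < Suc (4 * b) \<and> \<not> bit m j \<and> 2 * b \<le> i + j \<and> i + j - 2 * b < length xs \<and>
     (xs ! (i + j - 2 * b), v) \<in> R ^^ k \<and> c + k \<le> b"

text \<open>\<open>v\<close> is path vertex number \<open>i\<close>, chosen but without a token as
  yet; a step serves \<open>v\<close>, moves on and halves the mask to shift the window. The last
  vertex is served in \<open>accept\<close>.\<close>

inductive der :: "nat \<Rightarrow> 'a \<Rightarrow> nat \<Rightarrow> nat \<Rightarrow> bool" where
  der_start: "der 0 s 0 0"
| der_step: "der i v m c \<Longrightarrow> assign i v m c j k \<Longrightarrow> (v, v') \<in> R \<Longrightarrow> der (Suc i) v' ((m + 2 ^ j) div 2) (c + k)"

definition accept :: bool where
  "accept \<longleftrightarrow> (\<exists>i m c j k. der i t m c \<and> assign i t m c j k \<and> Suc i = length xs)"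

text \<open>Two lengths are kept because the walk has \<open>i\<close> arcs while the vertices
  already served number \<open>i\<close> during the recursion and \<open>Suc i\<close> at its end.
  The cost bound is stated separately.\<close>

definition cheap_assignment :: "nat \<Rightarrow> 'a \<Rightarrow> nat \<Rightarrow> (nat \<Rightarrow> 'a) \<Rightarrow> (nat \<Rightarrow> nat) \<Rightarrow> (nat \<Rightarrow> nat) \<Rightarrow> bool" where
  "cheap_assignment i v l f \<pi> w \<longleftrightarrow> walk_seq R s v i f \<and> inj_on \<pi> {..<l} \<and>
     (\<forall>i<l. \<pi> i < length xs \<and> (xs ! \<pi> i, f i) \<in> R ^^ w i)"

text \<open>The third premise says that the mask records every used token still in the window. A
  token in the window whose bit is free has therefore not been used, which keeps
  \<open>\<pi>\<close> injective.\<close>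

lemma cheap_assignment_extend:
  assumes "cheap_assignment i v i f \<pi> w" "assign i v m c j k"
    and "\<And>i'. i' < i \<Longrightarrow> i \<le> \<pi> i' + 2 * b \<Longrightarrow> bit m (\<pi> i' + 2 * b - i)"
  shows "cheap_assignment i v (Suc i) f (\<pi>(i := i + j - 2 * b)) (w(i := k))"
proof -
  let ?q = "i + j - 2 * b"
  have "\<pi> i' \<noteq> ?q" if "i' < i" for i'
  proof
    assume "\<pi> i' = ?q"
    then have "i \<le> \<pi> i' + 2 * b" "\<pi> i' + 2 * b - i = j" using assms(2) by (auto simp: assign_def)
    with assms(2) assms(3)[OF that] show False by (auto simp: assign_def)
  qed
  then have q: "?q \<notin> \<pi> ` {..<i}" by (metis imageE lessThan_iff)
  moreover have "inj_on \<pi> {..<i}" using assms(1) by (simp add: cheap_assignment_def)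
  ultimately have "inj_on (\<pi>(i := ?q)) {..<i}" by (rule inj_on_fun_updI[rotated])
  then have "inj_on (\<pi>(i := ?q)) {..<Suc i}"
    using q by (simp add: lessThan_Suc)
  moreover have "f i = v" using assms(1) by (simp add: cheap_assignment_def walk_seq_def)
  ultimately show ?thesis using assms(1,2)
    by (auto simp: cheap_assignment_def assign_def less_Suc_eq)
qed

lemma der_sound:
  "der i v m c \<Longrightarrow> \<exists>f \<pi> w. cheap_assignment i v i f \<pi> w \<and> sum w {..<i} = c \<and>
     (\<forall>i'<i. i \<le> \<pi> i' + 2 * b \<longrightarrow> bit m (\<pi> i' + 2 * b - i))"
proof (induction rule: der.induct)
  case der_start
  show ?case by (rule exI[of _ "\<lambda>_. s"]) (auto simp: cheap_assignment_def walk_seq_def)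
next
  case (der_step i v m c j k v')
  then obtain f \<pi> w where IH: "cheap_assignment i v i f \<pi> w" "sum w {..<i} = c"
    "\<And>i'. i' < i \<Longrightarrow> i \<le> \<pi> i' + 2 * b \<Longrightarrow> bit m (\<pi> i' + 2 * b - i)"
    by auto
  let ?f = "f(Suc i := v')" and ?\<pi> = "\<pi>(i := i + j - 2 * b)" and ?w = "w(i := k)"
  have 1: "cheap_assignment i v (Suc i) f ?\<pi> ?w"
    using cheap_assignment_extend[OF IH(1) der_step.hyps(2) IH(3)] by blast
  have "walk_seq R s v' (Suc i) ?f"
    using 1 der_step.hyps(3) by (auto simp: cheap_assignment_def walk_seq_def)
  moreover have "\<forall>i'<Suc i. ?\<pi> i' < length xs \<and> (xs ! ?\<pi> i', ?f i') \<in> R ^^ ?w i'"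
    using 1 by (auto simp: cheap_assignment_def)
  ultimately have "cheap_assignment (Suc i) v' (Suc i) ?f ?\<pi> ?w"
    using 1 by (simp add: cheap_assignment_def)
  moreover have "sum ?w {..<Suc i} = c + k" using IH(2) by simp
  moreover have "bit ((m + 2 ^ j) div 2) (?\<pi> i' + 2 * b - Suc i)"
    if i': "i' < Suc i" "Suc i \<le> ?\<pi> i' + 2 * b" for i'
  proof -
    have j: "\<not> bit m j" "2 * b \<le> i + j" using der_step.hyps(2) by (auto simp: assign_def)
    have Suc: "Suc (?\<pi> i' + 2 * b - Suc i) = ?\<pi> i' + 2 * b - i" using i'(2) by simp
    have "bit (m + 2 ^ j) (?\<pi> i' + 2 * b - i)"
    proof (cases "i' = i")
      case True
      then show ?thesis using j by (simp add: bit_add_power)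
    next
      case False
      then show ?thesis using i' IH(3)[of i'] j(1) by (simp add: bit_add_power)
    qed
    then show ?thesis unfolding Suc[symmetric] by (simp add: bit_Suc)
  qed
  ultimately show ?case by blast
qed

lemma accept_sound:
  assumes accept
  shows "\<exists>d f \<pi> w. length xs = Suc d \<and> cheap_assignment d t (Suc d) f \<pi> w \<and> sum w {..d} \<le> b"
proof -
  from assms obtain i m c j k where a: "der i t m c" "assign i t m c j k" "Suc i = length xs"
    by (auto simp: accept_def)
  from der_sound[OF a(1)] obtain f \<pi> w where f: "cheap_assignment i t i f \<pi> w" "sum w {..<i} = c"
    "\<And>i'. i' < i \<Longrightarrow> i \<le> \<pi> i' + 2 * b \<Longrightarrow> bit m (\<pi> i' + 2 * b - i)"
    by auto
  have "cheap_assignment i t (Suc i) f (\<pi>(i := i + j - 2 * b)) (w(i := k))"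
    using cheap_assignment_extend[OF f(1) a(2) f(3)] by blast
  moreover have "sum (w(i := k)) {..i} \<le> b"
    using f(2) a(2) by (simp add: assign_def flip: lessThan_Suc_atMost)
  ultimately show ?thesis using a(3) by metis
qed

text \<open>Soundness only asks that used tokens have their bits set; here the bits must be known
  exactly, so that the token prescribed by \<open>\<pi>\<close> is found free. \<open>near\<close>
  places that token in the window.\<close>

lemma accept_complete:
  assumes len: "length xs = Suc d" and ass: "cheap_assignment d t (Suc d) f \<pi> w" and cost: "sum w {..d} \<le> b"
    and near: "\<And>i. i \<le> d \<Longrightarrow> \<pi> i \<le> i + 2 * b \<and> i \<le> \<pi> i + 2 * b"
  shows accept
proof -
  have \<pi>: "inj_on \<pi> {..<Suc d}" and f: "walk_seq R s t d f"
    and w: "\<And>i. i \<le> d \<Longrightarrow> \<pi> i < length xs \<and> (xs ! \<pi> i, f i) \<in> R ^^ w i"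
    using ass by (auto simp: cheap_assignment_def)
  have assign: "assign i (f i) m (sum w {..<i}) (\<pi> i + 2 * b - i) (w i)"
    if i: "i \<le> d" and m: "\<And>k. bit m k \<longleftrightarrow> (\<exists>i'<i. i \<le> \<pi> i' + 2 * b \<and> k = \<pi> i' + 2 * b - i)" for i m
  proof -
    have "\<not> bit m (\<pi> i + 2 * b - i)"
    proof
      assume "bit m (\<pi> i + 2 * b - i)"
      then obtain i' where i': "i' < i" "i \<le> \<pi> i' + 2 * b" "\<pi> i + 2 * b - i = \<pi> i' + 2 * b - i"
        unfolding m by blast
      then have "\<pi> i = \<pi> i'" using near[OF i] by linarith
      with inj_onD[OF \<pi> this] i' i show False by simp
    qed
    moreover have "sum w {..<i} + w i \<le> b"
    proof -
      have "sum w {..<Suc i} \<le> sum w {..d}" using i by (intro sum_mono2) auto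
      with cost show ?thesis by simp
    qed
    ultimately show ?thesis using near[OF i] w[OF i] by (auto simp: assign_def)
  qed
  have "\<exists>m. der i (f i) m (sum w {..<i}) \<and> (\<forall>k. bit m k \<longleftrightarrow> (\<exists>i'<i. i \<le> \<pi> i' + 2 * b \<and> k = \<pi> i' + 2 * b - i))"
    if "i \<le> d" for i
    using that
  proof (induction i)
    case 0
    have "f 0 = s" using f by (simp add: walk_seq_def)
    then show ?case using der_start by (intro exI[of _ 0]) auto
  next
    case (Suc i)
    then obtain m where m: "der i (f i) m (sum w {..<i})"
      "\<And>k. bit m k \<longleftrightarrow> (\<exists>i'<i. i \<le> \<pi> i' + 2 * b \<and> k = \<pi> i' + 2 * b - i)"
      by auto
    let ?j = "\<pi> i + 2 * b - i"
    have i: "i \<le> d" using Suc.prems by simp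
    have a: "assign i (f i) m (sum w {..<i}) ?j (w i)" by (rule assign[OF i m(2)])
    have "(f i, f (Suc i)) \<in> R" using f Suc.prems by (auto simp: walk_seq_def)
    from der_step[OF m(1) a this]
    have "der (Suc i) (f (Suc i)) ((m + 2 ^ ?j) div 2) (sum w {..<Suc i})" by simp
    moreover have "bit ((m + 2 ^ ?j) div 2) k \<longleftrightarrow>
        (\<exists>i'<Suc i. Suc i \<le> \<pi> i' + 2 * b \<and> k = \<pi> i' + 2 * b - Suc i)" for k
    proof -
      \<comment> \<open>Halving forgets bit 0, the place of token number \<open>i - 2 * b\<close>,
        which leaves the window when \<open>i\<close> grows by one.\<close>
      have "bit ((m + 2 ^ ?j) div 2) k \<longleftrightarrow> bit (m + 2 ^ ?j) (Suc k)" by (simp add: bit_Suc)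
      also have "\<dots> \<longleftrightarrow> bit m (Suc k) \<or> Suc k = ?j"
        using a by (intro bit_add_power) (simp add: assign_def)
      also have "\<dots> \<longleftrightarrow> (\<exists>i'<Suc i. i \<le> \<pi> i' + 2 * b \<and> Suc k = \<pi> i' + 2 * b - i)"
        unfolding m(2) using near[OF i] by (auto simp: less_Suc_eq)
      also have "\<dots> \<longleftrightarrow> (\<exists>i'<Suc i. Suc i \<le> \<pi> i' + 2 * b \<and> k = \<pi> i' + 2 * b - Suc i)"
        by (rule ex_cong1) auto
      finally show ?thesis .
    qed
    ultimately show ?case by blast
  qed
  from this[of d] obtain m where m: "der d (f d) m (sum w {..<d})"
    "\<And>k. bit m k \<longleftrightarrow> (\<exists>i'<d. d \<le> \<pi> i' + 2 * b \<and> k = \<pi> i' + 2 * b - d)"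
    by auto
  have "f d = t" using f by (simp add: walk_seq_def)
  with m(1) assign[OF order.refl m(2)] len show accept unfolding accept_def by metis
qed

lemma der_bounds: "der i v m c \<Longrightarrow> m < 2 ^ Suc (4 * b) \<and> c \<le> b"
proof (induction rule: der.induct)
  case (der_step i v m c j k v')
  then have "(m + 2 ^ j) div 2 < 2 ^ Suc (4 * b)"
    by (intro shifted_mask_less) (auto simp: assign_def)
  with der_step.hyps show ?case by (simp add: assign_def)
qed simp

lemma der_range: "der i v m c \<Longrightarrow> v = s \<or> v \<in> snd ` R"
  by (induction rule: der.induct) force+

end

section \<open>Tokens sorted by their distance from \<open>s\<close>\<close>

definition layer :: "('a \<times> 'a) set \<Rightarrow> 'a \<Rightarrow> 'a \<Rightarrow> nat \<Rightarrow> bool" where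
  "layer R s v k \<longleftrightarrow> (s, v) \<in> R ^^ k \<and> (\<forall>k'<k. (s, v) \<notin> R ^^ k')"

text \<open>Collecting layer by layer sorts by distance, with ties broken by vertex number. Tokens
  not reached in fewer than \<open>K\<close> steps are missing, so the list can be shorter than
  \<open>S\<close> is large.\<close>

definition layered_tokens :: "(nat \<times> nat) set \<Rightarrow> nat \<Rightarrow> nat set \<Rightarrow> nat \<Rightarrow> nat \<Rightarrow> nat list" where
  "layered_tokens R s S n K = concat (map (\<lambda>k. filter (\<lambda>v. v \<in> S \<and> layer R s v k) [0..<n]) [0..<K])"

text \<open>Unspecified if \<open>v\<close> cannot be reached from \<open>s\<close>; its value
  matters only where reachability is known.\<close>

definition level :: "('a \<times> 'a) set \<Rightarrow> 'a \<Rightarrow> 'a \<Rightarrow> nat" where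
  "level R s v = (LEAST k. (s, v) \<in> R ^^ k)"

lemma layer_level: "layer R s v k \<longleftrightarrow> (s, v) \<in> R ^^ k \<and> level R s v = k"
proof
  assume "layer R s v k"
  then show "(s, v) \<in> R ^^ k \<and> level R s v = k"
    unfolding layer_def level_def by (metis (mono_tags, lifting) LeastI Least_le le_neq_implies_less)
next
  assume "(s, v) \<in> R ^^ k \<and> level R s v = k"
  then show "layer R s v k" unfolding layer_def level_def using not_less_Least by blast
qed

lemma level_le: "(s, v) \<in> R ^^ k \<Longrightarrow> level R s v \<le> k"
  unfolding level_def by (rule Least_le)

lemma level_reach: "(s, v) \<in> R ^^ k \<Longrightarrow> (s, v) \<in> R ^^ level R s v"
  unfolding level_def by (rule LeastI)

lemma layered_tokens_Suc:
  "layered_tokens R s S n (Suc K) = layered_tokens R s S n K @ filter (\<lambda>v. v \<in> S \<and> layer R s v K) [0..<n]"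
  by (simp add: layered_tokens_def)

lemma set_layered_tokens:
  "set (layered_tokens R s S n K) = {v. v < n \<and> v \<in> S \<and> (\<exists>k<K. (s, v) \<in> R ^^ k)}"
proof -
  have "(\<exists>k<K. layer R s v k) \<longleftrightarrow> (\<exists>k<K. (s, v) \<in> R ^^ k)" for v
    unfolding layer_level using level_le level_reach le_less_trans by metis
  moreover have "set (layered_tokens R s S n K) = {v. v < n \<and> v \<in> S \<and> (\<exists>k<K. layer R s v k)}"
    unfolding layered_tokens_def by auto
  ultimately show ?thesis by simp
qed

lemma distinct_layered_tokens: "distinct (layered_tokens R s S n K)"
proof (induction K)
  case (Suc K)
  have "set (layered_tokens R s S n K) \<inter> set (filter (\<lambda>v. v \<in> S \<and> layer R s v K) [0..<n]) = {}"
    by (auto simp: set_layered_tokens layer_def)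
  with Suc show ?case by (simp add: layered_tokens_Suc)
qed (simp add: layered_tokens_def)

lemma sorted_layered_tokens: "sorted (map (level R s) (layered_tokens R s S n K))"
proof (induction K)
  case (Suc K)
  have "level R s v \<le> K" if "v \<in> set (layered_tokens R s S n K)" for v
  proof -
    from that obtain k where "k < K" "(s, v) \<in> R ^^ k" unfolding set_layered_tokens by blast
    then show ?thesis using level_le[OF \<open>(s, v) \<in> R ^^ k\<close>] by simp
  qed
  moreover have "sorted (map (level R s) ys)" if "\<forall>v\<in>set ys. level R s v = K" for ys
    using that by (induction ys) auto
  then have "sorted (map (level R s) (filter (\<lambda>v. v \<in> S \<and> layer R s v K) [0..<n]))"
    by (simp add: layer_level)
  ultimately show ?case using Suc
    unfolding layered_tokens_Suc map_append sorted_append by (auto simp: layer_level)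
qed (simp add: layered_tokens_def)

lemma length_layered_tokens: "length (layered_tokens R s S n K) \<le> n"
proof -
  have "card (set (layered_tokens R s S n K)) \<le> card {..<n}"
    by (intro card_mono) (auto simp: set_layered_tokens)
  then show ?thesis using distinct_card[OF distinct_layered_tokens, of R s S n K] by simp
qed

text \<open>Why \<open>n + b + 1\<close> layers suffice: in a yes-instance every token is at most
  \<open>b\<close> steps away from a path vertex, whose distance from \<open>s\<close> is at most
  \<open>d < n\<close>.\<close>

lemma spd_yes_iff_accept:
  assumes x: "x \<in> spd_instances" and n: "pverts (spd_graph x) = {..<n}"
  shows "x \<in> spd_yes_instances \<longleftrightarrow> token_dp.accept (parcs (spd_graph x)) (spd_s x) (spd_t x) (spd_b x)
    (layered_tokens (parcs (spd_graph x)) (spd_s x) (spd_S x) n (n + spd_b x + 1))"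
proof -
  define G R s t S b where "G = spd_graph x" "R = parcs (spd_graph x)" "s = spd_s x" "t = spd_t x"
    "S = spd_S x" "b = spd_b x"
  note defs = this
  define xs where "xs = layered_tokens R s S n (n + b + 1)"
  have G: "pair_graph G" "s \<in> pverts G" "S \<subseteq> pverts G" and vG: "pverts G = {..<n}" and RG: "R = parcs G"
    using x n by (auto simp: spd_instances_def defs)
  interpret pair_graph G by (rule G(1))
  have symR: "sym R" unfolding RG using pair_sym_arcs by (auto simp: symmetric_def)
  have finS: "finite S" using G(3) vG finite_subset by auto
  obtain p0 where p0: "shortest_path G s p0 t" "card S = card (path_vertices s p0)"
    using x by (auto simp: spd_instances_def defs)
  define d where "d = length p0"
  have dmin: "\<And>k. k < d \<Longrightarrow> (s, t) \<notin> R ^^ k" and cardS: "card S = Suc d" and dn: "d < n"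
  proof -
    obtain f where f: "walk_seq (parcs G) s t (length p0) f" "path_vertices s p0 = f ` {..length p0}"
      "\<And>k. k < length p0 \<Longrightarrow> (s, t) \<notin> parcs G ^^ k" "card (path_vertices s p0) = Suc (length p0)"
      using shortest_pathD[OF G(1) p0(1)] by blast
    show "\<And>k. k < d \<Longrightarrow> (s, t) \<notin> R ^^ k" "card S = Suc d" using f p0(2) by (auto simp: d_def RG)
    then show "d < n" using card_mono[of "{..<n}" S] G(3) vG by simp
  qed
  have xsS: "set xs \<subseteq> S" by (auto simp: xs_def set_layered_tokens)
  have dxs: "distinct xs" unfolding xs_def by (rule distinct_layered_tokens)
  interpret token_dp R s t b xs .
  have yes: "x \<in> spd_yes_instances \<longleftrightarrow>
     (\<exists>C l p. discovery_sequence G C l \<and> C 0 = S \<and> l \<le> b \<and> shortest_path G s p t \<and> C l = path_vertices s p)"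
    using x by (simp add: spd_yes_instances_def defs)
  have "x \<in> spd_yes_instances \<longleftrightarrow> accept"
  proof
    assume accept
    then obtain e f \<pi> w where e: "length xs = Suc e" "cheap_assignment e t (Suc e) f \<pi> w" "sum w {..e} \<le> b"
      using accept_sound by blast
    from e(2) have f: "walk_seq R s t e f" and inj: "inj_on \<pi> {..<Suc e}"
      and w: "\<And>i. i \<le> e \<Longrightarrow> \<pi> i < length xs \<and> (xs ! \<pi> i, f i) \<in> R ^^ w i"
      by (auto simp: cheap_assignment_def)
    \<comment> \<open>The list may lack tokens that are too far away, which gives only
      \<open>e \<le> d\<close>; the walk \<open>f\<close> from \<open>s\<close> to \<open>t\<close>
      gives \<open>d \<le> e\<close>. So all tokens are listed and \<open>f\<close> runs along a
      shortest path.\<close>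
    have "Suc e \<le> card S" using card_mono[OF finS xsS] distinct_card[OF dxs] e(1) by simp
    moreover have "\<not> e < d" using walk_seq_relpow[OF f] dmin by blast
    ultimately have ed: "e = d" using cardS by simp
    have "set xs = S" using card_subset_eq[OF finS xsS] distinct_card[OF dxs] e(1) ed cardS by simp
    have "\<pi> ` {..d} \<subseteq> {..d}" using w e(1) ed by (auto simp: less_Suc_eq_le)
    then have "\<pi> ` {..d} = {..d}"
      using inj ed by (intro endo_inj_surj) (auto simp: lessThan_Suc_atMost)
    then have \<pi>: "bij_betw \<pi> {..d} {..d}" using inj ed by (simp add: bij_betw_def lessThan_Suc_atMost)
    have "bij_betw ((!) xs) {..d} S"
      using bij_betw_nth[OF dxs, of "{..d}" S] \<open>set xs = S\<close> e(1) ed by (auto simp: lessThan_Suc_atMost)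
    with \<pi> have h: "bij_betw (\<lambda>i. xs ! \<pi> i) {..d} S"
      using bij_betw_trans[of \<pi> "{..d}" "{..d}" "(!) xs" S] by (simp add: comp_def)
    obtain p where p: "shortest_path G s p t" "path_vertices s p = f ` {..d}"
      using shortest_pathI[OF G(1,2), of t d f] f ed dmin by (auto simp: RG)
    obtain f' where f': "walk_seq (parcs G) s t (length p) f'" "path_vertices s p = f' ` {..length p}"
      "\<And>k. k < length p \<Longrightarrow> (s, t) \<notin> parcs G ^^ k" "card (path_vertices s p) = Suc (length p)"
      using shortest_pathD[OF G(1) p(1)] by blast
    have "length p = d"
      using f'(1,3) dmin walk_seq_relpow[OF f] walk_seq_relpow ed unfolding RG by (meson linorder_neqE_nat)
    then have "card (f ` {..d}) = card {..d}" using p(2) f'(4) by simp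
    then have injf: "inj_on f {..d}" by (intro eq_card_imp_inj_on) auto
    let ?k = "inv_into {..d} (\<lambda>i. xs ! \<pi> i)"
    have k: "bij_betw ?k S {..d}" using h by (rule bij_betw_inv_into)
    have "cheap_matching R S (f ` {..d}) b"
      unfolding cheap_matching_def
    proof (intro exI conjI ballI)
      show "bij_betw (f \<circ> ?k) S (f ` {..d})"
        using k injf by (intro bij_betw_trans[OF k]) (simp add: bij_betw_def)
      show "(u, (f \<circ> ?k) u) \<in> R ^^ (w \<circ> ?k) u" if "u \<in> S" for u
      proof -
        have "?k u \<le> d" using bij_betwE[OF k] that by auto
        moreover have "xs ! \<pi> (?k u) = u" using bij_betw_inv_into_right[OF h that] .
        ultimately show ?thesis using w[of "?k u"] ed by auto
      qed
      have "sum (w \<circ> ?k) S = sum w {..d}" using sum.reindex_bij_betw[OF k] by simp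
      then show "sum (w \<circ> ?k) S \<le> b" using e(3) ed by simp
    qed
    then obtain C l where "discovery_sequence G C l" "C 0 = S" "C l = f ` {..d}" "l \<le> b"
      using cheap_matching_imp_discovery[of G S "f ` {..d}" b] symR G(3) finS pair_wf_digraph
      unfolding RG by blast
    then show "x \<in> spd_yes_instances" unfolding yes using p by metis
  next
    assume "x \<in> spd_yes_instances"
    then obtain C l p where C: "discovery_sequence G C l" "C 0 = S" "l \<le> b" "shortest_path G s p t"
      "C l = path_vertices s p"
      unfolding yes by blast
    obtain f where f: "walk_seq (parcs G) s t (length p) f" "path_vertices s p = f ` {..length p}"
      "\<And>k. k < length p \<Longrightarrow> (s, t) \<notin> parcs G ^^ k" "card (path_vertices s p) = Suc (length p)"
      using shortest_pathD[OF G(1) C(4)] by blast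
    have "cheap_matching R S (f ` {..length p}) l"
      using discovery_imp_cheap_matching[OF C(1)] C(2,5) f(2) symR finS RG by simp
    then obtain g w where g: "bij_betw g S (f ` {..length p})" "\<And>u. u \<in> S \<Longrightarrow> (u, g u) \<in> R ^^ w u"
      "sum w S \<le> b"
      unfolding cheap_matching_def using C(3) le_trans by blast
    have pd: "length p = d"
      using bij_betw_same_card[OF g(1)] f(2,4) cardS by simp
    have fS: "walk_seq R s t d f" using f(1) pd RG by simp
    have injf: "inj_on f {..d}" using f(2,4) pd by (intro eq_card_imp_inj_on) auto
    have wb: "w u \<le> b" if "u \<in> S" for u
      using member_le_sum[OF that _ finS, of w] g(3) by simp
    have reach: "(s, u) \<in> R ^^ (i + w u)" "level R s u \<le> i + b" "i \<le> level R s u + b"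
      if u: "u \<in> S" "i \<le> d" "g u = f i" for u i
    proof -
      have ui: "(f i, u) \<in> R ^^ w u" using relpow_sym[OF symR g(2)[OF u(1)]] u(3) by simp
      with walk_seq_prefix[OF fS u(2)] show su: "(s, u) \<in> R ^^ (i + w u)" by (rule relpow_comp)
      then show "level R s u \<le> i + b" using level_le[OF su] wb[OF u(1)] by fastforce
      \<comment> \<open>The lower bound on the level uses that the path is shortest: going to
        \<open>u\<close>, on to \<open>f i\<close> and along the rest of the path takes at least
        \<open>d\<close> steps.\<close>
      have "(s, f i) \<in> R ^^ (level R s u + w u)"
        using relpow_comp[OF level_reach[OF su] g(2)[OF u(1)]] u(3) by simp
      from relpow_comp[OF this walk_seq_suffix[OF fS u(2)]]
      have "\<not> level R s u + w u + (d - i) < d" using dmin by blast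
      then show "i \<le> level R s u + b" using wb[OF u(1)] u(2) by linarith
    qed
    have "S \<subseteq> set xs"
    proof
      fix u assume u: "u \<in> S"
      then obtain i where i: "i \<le> d" "g u = f i" using bij_betwE[OF g(1)] pd by auto
      have "i + w u < n + b + 1" using i(1) dn wb[OF u] by simp
      with reach(1)[OF u i] u G(3) vG show "u \<in> set xs"
        unfolding xs_def set_layered_tokens by blast
    qed
    then have xsS: "set xs = S" using xsS by blast
    then have len: "length xs = Suc d" using distinct_card[OF dxs] cardS by simp
    have bxs: "bij_betw ((!) xs) {..d} S"
      using bij_betw_nth[OF dxs, of "{..d}" S] xsS len by (auto simp: lessThan_Suc_atMost)
    \<comment> \<open>\<open>\<rho>\<close> sends a token number to the number of the path vertex
      matched with it; the recursion picks a token for each path vertex, hence the inverse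
      \<open>\<pi>\<close> below.\<close>
    define \<rho> where "\<rho> = inv_into {..d} f \<circ> g \<circ> (!) xs"
    have "bij_betw f {..d} (f ` {..d})" using injf by (simp add: bij_betw_def)
    from bij_betw_inv_into[OF this] have "bij_betw (inv_into {..d} f) (f ` {..d}) {..d}" .
    then have \<rho>: "bij_betw \<rho> {..d} {..d}"
      unfolding \<rho>_def using g(1) pd bxs by (metis bij_betw_trans)
    define \<pi> where "\<pi> = inv_into {..d} \<rho>"
    have \<pi>: "bij_betw \<pi> {..d} {..d}" unfolding \<pi>_def using \<rho> by (rule bij_betw_inv_into)
    have \<pi>d: "\<pi> i \<le> d" if "i \<le> d" for i using bij_betwE[OF \<pi>] that by auto
    have u: "xs ! \<pi> i \<in> S" "g (xs ! \<pi> i) = f i" if i: "i \<le> d" for i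
    proof -
      show S: "xs ! \<pi> i \<in> S" using bij_betwE[OF bxs] \<pi>d[OF i] by auto
      then have "g (xs ! \<pi> i) \<in> f ` {..d}" using bij_betwE[OF g(1)] pd by auto
      then have "f (\<rho> (\<pi> i)) = g (xs ! \<pi> i)" by (simp add: \<rho>_def f_inv_into_f)
      moreover have "\<rho> (\<pi> i) = i" unfolding \<pi>_def using bij_betw_inv_into_right[OF \<rho>] i by simp
      ultimately show "g (xs ! \<pi> i) = f i" by simp
    qed
    have near: "\<pi> i \<le> i + 2 * b \<and> i \<le> \<pi> i + 2 * b" if "i \<le> d" for i
    proof (rule banded_bijection[OF \<pi> _ _ that, of "\<lambda>i. level R s (xs ! i)"])
      show "level R s (xs ! i) \<le> level R s (xs ! j)" if "i \<le> j" "j \<le> d" for i j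
        using sorted_nth_mono[OF sorted_layered_tokens[of R s S n "n + b + 1"], of i j] that len
        by (simp add: xs_def)
      show "level R s (xs ! \<pi> i) \<le> i + b \<and> i \<le> level R s (xs ! \<pi> i) + b" if "i \<le> d" for i
        using reach(2,3) u that by blast
    qed
    have "cheap_assignment d t (Suc d) f \<pi> (\<lambda>i. w (xs ! \<pi> i))"
      unfolding cheap_assignment_def
    proof (intro conjI allI impI)
      show "walk_seq R s t d f" by (rule fS)
      show "inj_on \<pi> {..<Suc d}" using \<pi> by (simp add: bij_betw_def lessThan_Suc_atMost)
      fix i assume "i < Suc d"
      then have i: "i \<le> d" by simp
      show "\<pi> i < length xs" using \<pi>d[OF i] len by simp
      show "(xs ! \<pi> i, f i) \<in> R ^^ w (xs ! \<pi> i)" using g(2)[OF u(1)[OF i]] u(2)[OF i] by simp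
    qed
    moreover have "(\<Sum>i\<le>d. w (xs ! \<pi> i)) \<le> b"
    proof -
      have "bij_betw (\<lambda>i. xs ! \<pi> i) {..d} S"
        using bij_betw_trans[OF \<pi> bxs] by (simp add: comp_def)
      from sum.reindex_bij_betw[OF this, of w] g(3) show ?thesis by simp
    qed
    ultimately show accept using accept_complete[OF len] near by blast
  qed
  then show ?thesis unfolding xs_def by (simp add: defs)
qed

section \<open>The program\<close>

text \<open>\<open>Minus\<close> truncates, so the inner sum is the absolute difference.\<close>

definition eqx :: "aexp \<Rightarrow> aexp \<Rightarrow> aexp" where
  "eqx a b = Minus (Const 1) (Plus (Minus a b) (Minus b a))"

lemma aval_eqx [simp]: "aval (eqx a b) \<sigma> \<noteq> 0 \<longleftrightarrow> aval a \<sigma> = aval b \<sigma>"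
  "aval (eqx a b) \<sigma> = 0 \<longleftrightarrow> aval a \<sigma> \<noteq> aval b \<sigma>"
  by (auto simp: eqx_def)

text \<open>Addresses need multiples, which the machine cannot compute directly; repeated addition
  tabulates them, and \<open>acc\<close> ends as the product of bound and factor.\<close>

definition mul_tab :: "string \<Rightarrow> string \<Rightarrow> string \<Rightarrow> string \<Rightarrow> lcom" where
  "mul_tab A N p acc = LSeq (LAssign acc (Const 0))
     (LFor ''q'' N (LSeq (LStore A (Reg ''q'') (Reg acc)) (LAssign acc (Plus (Reg acc) (Reg p)))))"

lemma mul_tab_simps [simp]:
  "wr (mul_tab A N p acc) = {''q'', acc}" "wa (mul_tab A N p acc) = {A}" "bounds (mul_tab A N p acc) = {N}"
  "well_formed (mul_tab A N p acc) \<longleftrightarrow> N \<noteq> ''q'' \<and> acc \<noteq> ''q'' \<and> N \<noteq> acc"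
  by (auto simp: mul_tab_def)

lemma sem_mul_tab:
  assumes "p \<notin> {''q'', acc}" "N \<notin> {''q'', acc}" "acc \<noteq> ''q''"
  shows "i < regs \<sigma> N \<Longrightarrow> arrays (sem (mul_tab A N p acc) \<sigma>) A i = i * regs \<sigma> p"
    and "regs (sem (mul_tab A N p acc) \<sigma>) acc = regs \<sigma> N * regs \<sigma> p"
proof -
  let ?\<sigma> = "set_reg acc 0 \<sigma>"
  let ?body = "LSeq (LStore A (Reg ''q'') (Reg acc)) (LAssign acc (Plus (Reg acc) (Reg p)))"
  have "(\<forall>i < regs \<sigma> N. arrays (sem (LFor ''q'' N ?body) ?\<sigma>) A i = i * regs \<sigma> p) \<and>
     regs (sem (LFor ''q'' N ?body) ?\<sigma>) acc = regs \<sigma> N * regs \<sigma> p"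
  proof (rule sem_LFor_induct[where P = "\<lambda>j \<tau>. (\<forall>i<j. arrays \<tau> A i = i * regs \<sigma> p) \<and> regs \<tau> acc = j * regs \<sigma> p"])
    fix j \<tau> assume *: "j < regs ?\<sigma> N" "(\<forall>i<j. arrays \<tau> A i = i * regs \<sigma> p) \<and> regs \<tau> acc = j * regs \<sigma> p"
      "agree (LFor ''q'' N ?body) ?\<sigma> \<tau>"
    have "regs \<tau> p = regs \<sigma> p" using agree_regs[OF *(3), of p] assms by auto
    with * assms show "(\<forall>i<Suc j. arrays (sem ?body (set_reg ''q'' j \<tau>)) A i = i * regs \<sigma> p) \<and>
        regs (sem ?body (set_reg ''q'' j \<tau>)) acc = Suc j * regs \<sigma> p"
      by (auto simp: less_Suc_eq)
  qed (use assms in auto)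
  then show "i < regs \<sigma> N \<Longrightarrow> arrays (sem (mul_tab A N p acc) \<sigma>) A i = i * regs \<sigma> p"
    "regs (sem (mul_tab A N p acc) \<sigma>) acc = regs \<sigma> N * regs \<sigma> p"
    by (simp_all add: mul_tab_def)
qed

text \<open>The matrix begins in cell \<open>n + 4\<close> of the input, after the four numbers and
  the \<open>n\<close> entries describing \<open>S\<close>; \<open>n4\<close> holds this
  offset.\<close>

definition adj :: "string \<Rightarrow> string \<Rightarrow> aexp" where
  "adj u v = Load ''in'' (Plus (Reg ''n4'') (Plus (Load ''rn'' (Reg u)) (Reg v)))"

text \<open>The first argument is already a multiple of \<open>n * n\<close>; the next layer is
  addressed by adding \<open>nn\<close>, which also reaches layer \<open>K\<close>, for which
  \<open>rnn\<close> has no entry.\<close>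

definition walk_addr :: "aexp \<Rightarrow> aexp \<Rightarrow> aexp \<Rightarrow> aexp" where
  "walk_addr k u v = Plus k (Plus (Load ''rn'' u) v)"

text \<open>Mixed-radix address with digits position, vertex, mask and cost. Again the leading part
  comes in multiplied form, and adding \<open>Z\<close> reaches level \<open>n\<close>, which is
  absent from \<open>ri\<close>.\<close>

definition state_addr :: "aexp \<Rightarrow> aexp \<Rightarrow> aexp \<Rightarrow> aexp \<Rightarrow> aexp" where
  "state_addr i v m c = Plus (Plus i (Load ''rv'' v)) (Plus (Load ''rm'' m) c)"

text \<open>Kept apart from the later pieces because it writes registers that serve as their loop
  bounds; for the same reason \<open>pow_prog\<close>, which is bounded by \<open>W\<close> and
  computes \<open>M\<close>, is not part of \<open>main_prog\<close>.\<close>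

definition setup_prog :: lcom where
  "setup_prog =
     LSeq (LAssign ''n'' (Load ''in'' (Const 0)))
    (LSeq (LAssign ''s'' (Load ''in'' (Const 1)))
    (LSeq (LAssign ''t'' (Load ''in'' (Const 2)))
    (LSeq (LAssign ''b'' (Load ''in'' (Const 3)))
    (LSeq (LAssign ''b1'' (Plus (Reg ''b'') (Const 1)))
    (LSeq (LAssign ''w'' (Plus (Reg ''b'') (Reg ''b'')))
    (LSeq (LAssign ''W'' (Plus (Plus (Reg ''w'') (Reg ''w'')) (Const 1)))
    (LSeq (LAssign ''K'' (Plus (Reg ''n'') (Reg ''b1'')))
          (LAssign ''n4'' (Plus (Reg ''n'') (Const 4))))))))))"

definition pow_prog :: lcom where
  "pow_prog = LSeq (LAssign ''M'' (Const 1))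
     (LFor ''q'' ''W'' (LSeq (LStore ''pw'' (Reg ''q'') (Reg ''M'')) (LAssign ''M'' (Plus (Reg ''M'') (Reg ''M'')))))"

text \<open>The products left by the calls are the place values for the next digits:
  \<open>nn\<close> for \<open>walk_addr\<close>, \<open>Q\<close> and \<open>Z\<close> for
  \<open>state_addr\<close>.\<close>

definition tab_prog :: lcom where
  "tab_prog =
     LSeq (mul_tab ''rn'' ''n'' ''n'' ''nn'')
    (LSeq (mul_tab ''rnn'' ''K'' ''nn'' ''kk'')
    (LSeq (mul_tab ''rm'' ''M'' ''b1'' ''Q'')
    (LSeq (mul_tab ''rv'' ''n'' ''Q'' ''Z'')
          (mul_tab ''ri'' ''n'' ''Z'' ''zz''))))"

definition walk_body :: lcom where
  "walk_body = guard [Load ''wk'' (walk_addr (Load ''rnn'' (Reg ''k'')) (Reg ''u'') (Reg ''v'')), adj ''v'' ''x'']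
     (LStore ''wk'' (walk_addr (Plus (Load ''rnn'' (Reg ''k'')) (Reg ''nn'')) (Reg ''u'') (Reg ''x'')) (Const 1))"

definition walk_prog :: lcom where
  "walk_prog = LSeq
     (LFor ''u'' ''n'' (LStore ''wk'' (walk_addr (Const 0) (Reg ''u'') (Reg ''u'')) (Const 1)))
     (LFor ''k'' ''K'' (nest [(''u'', ''n''), (''v'', ''n''), (''x'', ''n'')] walk_body))"

text \<open>\<open>wk\<close> knows walk lengths, not distances; the test of \<open>placed\<close>
  lets only the first \<open>k\<close> count, which is the distance.\<close>

definition token_body :: lcom where
  "token_body = guard
     [Load ''in'' (Plus (Reg ''v'') (Const 4)),
      Load ''wk'' (walk_addr (Load ''rnn'' (Reg ''k'')) (Reg ''s'') (Reg ''v'')),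
      Minus (Const 1) (Load ''placed'' (Reg ''v''))]
     (LSeq (LStore ''placed'' (Reg ''v'') (Const 1))
     (LSeq (LStore ''tok'' (Plus (Reg ''w'') (Reg ''cnt'')) (Plus (Reg ''v'') (Const 1)))
           (LAssign ''cnt'' (Plus (Reg ''cnt'') (Const 1)))))"

definition token_prog :: lcom where
  "token_prog = LFor ''k'' ''K'' (LFor ''v'' ''n'' token_body)"

text \<open>Division by a power of two. The natural bound \<open>j\<close> is itself a loop variable
  of the surrounding nest, and bounds must not be written; so the loop makes \<open>W\<close> passes
  and halves in the first \<open>j\<close> only.\<close>

definition shift_prog :: lcom where
  "shift_prog = LSeq (LAssign ''x'' (Reg ''m''))
     (LFor ''q'' ''W'' (LIf (Minus (Reg ''j'') (Reg ''q'')) (LAssign ''x'' (Half (Reg ''x''))) LSkip))"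

text \<open>The guards are a table lookup and the clauses of \<open>assign\<close>. With
  \<open>x\<close> the mask shifted by \<open>j\<close>, the second one tests that bit
  \<open>j\<close> is 0; a nonzero \<open>tok\<close> cell covers both index conditions. The range
  of \<open>j\<close> is left to its loop.\<close>

definition dp_update :: lcom where
  "dp_update = guard
     [Load ''A'' (state_addr (Load ''ri'' (Reg ''i'')) (Reg ''v'') (Reg ''m'') (Reg ''c'')),
      eqx (Reg ''x'') (Plus (Half (Reg ''x'')) (Half (Reg ''x''))),
      Load ''tok'' (Plus (Reg ''i'') (Reg ''j'')),
      Load ''wk'' (walk_addr (Load ''rnn'' (Reg ''k''))
        (Minus (Load ''tok'' (Plus (Reg ''i'') (Reg ''j''))) (Const 1)) (Reg ''v'')),
      Minus (Reg ''b1'') (Plus (Reg ''c'') (Reg ''k''))]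
     (LSeq
       (guard [adj ''v'' ''y'']
         (LStore ''A'' (state_addr (Plus (Load ''ri'' (Reg ''i'')) (Reg ''Z'')) (Reg ''y'')
            (Half (Plus (Reg ''m'') (Load ''pw'' (Reg ''j'')))) (Plus (Reg ''c'') (Reg ''k''))) (Const 1)))
       (guard [eqx (Plus (Reg ''i'') (Const 1)) (Reg ''cnt''), eqx (Reg ''v'') (Reg ''t'')]
         (LAssign ''out'' (Const 1))))"

definition dp_body :: lcom where "dp_body = LSeq shift_prog dp_update"

definition dp_nest :: lcom where
  "dp_nest = nest [(''v'', ''n''), (''m'', ''M''), (''c'', ''b1''), (''j'', ''W''), (''k'', ''K''), (''y'', ''n'')] dp_body"

definition dp_prog :: lcom where
  "dp_prog = LSeq (LStore ''A'' (Load ''rv'' (Reg ''s'')) (Const 1)) (LFor ''i'' ''n'' dp_nest)"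

definition main_prog :: lcom where
  "main_prog = LSeq tab_prog (LSeq walk_prog (LSeq token_prog dp_prog))"

section \<open>Write sets and loop bounds of the program pieces\<close>

lemma setup_prog_frame [simp]:
  "wr setup_prog = {''n'', ''s'', ''t'', ''b'', ''b1'', ''w'', ''W'', ''K'', ''n4''}" "wa setup_prog = {}"
  "bounds setup_prog = {}" "well_formed setup_prog"
  unfolding setup_prog_def by auto

lemma pow_prog_frame [simp]:
  "wr pow_prog = {''q'', ''M''}" "wa pow_prog = {''pw''}" "bounds pow_prog = {''W''}" "well_formed pow_prog"
  unfolding pow_prog_def by auto

lemma tab_prog_frame [simp]:
  "wr tab_prog = {''q'', ''nn'', ''kk'', ''Q'', ''Z'', ''zz''}" "wa tab_prog = {''rn'', ''rnn'', ''rm'', ''rv'', ''ri''}"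
  "bounds tab_prog = {''n'', ''K'', ''M''}" "well_formed tab_prog"
  unfolding tab_prog_def by auto

lemma walk_body_frame [simp]: "wr walk_body = {}" "wa walk_body = {''wk''}" "bounds walk_body = {}" "well_formed walk_body"
  unfolding walk_body_def by auto

lemma walk_prog_frame [simp]:
  "wr walk_prog = {''u'', ''k'', ''v'', ''x''}" "wa walk_prog = {''wk''}" "bounds walk_prog = {''n'', ''K''}" "well_formed walk_prog"
  unfolding walk_prog_def by auto

lemma token_body_frame [simp]:
  "wr token_body = {''cnt''}" "wa token_body = {''placed'', ''tok''}" "bounds token_body = {}" "well_formed token_body"
  unfolding token_body_def by auto

lemma token_prog_frame [simp]:
  "wr token_prog = {''k'', ''v'', ''cnt''}" "wa token_prog = {''placed'', ''tok''}" "bounds token_prog = {''n'', ''K''}" "well_formed token_prog"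
  unfolding token_prog_def by auto

lemma shift_prog_frame [simp]:
  "wr shift_prog = {''x'', ''q''}" "wa shift_prog = {}" "bounds shift_prog = {''W''}" "well_formed shift_prog"
  unfolding shift_prog_def by auto

lemma dp_update_frame [simp]:
  "wr dp_update = {''out''}" "wa dp_update = {''A''}" "bounds dp_update = {}" "well_formed dp_update"
  unfolding dp_update_def by auto

lemma dp_body_frame [simp]:
  "wr dp_body = {''x'', ''q'', ''out''}" "wa dp_body = {''A''}" "bounds dp_body = {''W''}" "well_formed dp_body"
  unfolding dp_body_def by auto

lemma dp_nest_frame [simp]:
  "wr dp_nest = {''v'', ''m'', ''c'', ''j'', ''k'', ''y'', ''x'', ''q'', ''out''}" "wa dp_nest = {''A''}"
  "bounds dp_nest = {''n'', ''M'', ''b1'', ''W'', ''K''}" "well_formed dp_nest"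
  unfolding dp_nest_def by auto

lemma dp_prog_frame [simp]:
  "wr dp_prog = {''i'', ''v'', ''m'', ''c'', ''j'', ''k'', ''y'', ''x'', ''q'', ''out''}" "wa dp_prog = {''A''}"
  "bounds dp_prog = {''n'', ''M'', ''b1'', ''W'', ''K''}" "well_formed dp_prog"
  unfolding dp_prog_def by auto

section \<open>Powers of two and shifts\<close>

lemma sem_pow_prog:
  "j < regs \<sigma> ''W'' \<Longrightarrow> arrays (sem pow_prog \<sigma>) ''pw'' j = 2 ^ j"
  "regs (sem pow_prog \<sigma>) ''M'' = 2 ^ regs \<sigma> ''W''"
proof -
  let ?body = "LSeq (LStore ''pw'' (Reg ''q'') (Reg ''M'')) (LAssign ''M'' (Plus (Reg ''M'') (Reg ''M'')))"
  let ?\<sigma> = "set_reg ''M'' 1 \<sigma>"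
  have "(\<forall>j < regs \<sigma> ''W''. arrays (sem (LFor ''q'' ''W'' ?body) ?\<sigma>) ''pw'' j = 2 ^ j) \<and>
    regs (sem (LFor ''q'' ''W'' ?body) ?\<sigma>) ''M'' = 2 ^ regs \<sigma> ''W''"
    by (rule sem_LFor_induct[where P = "\<lambda>j \<tau>. (\<forall>i<j. arrays \<tau> ''pw'' i = 2 ^ i) \<and> regs \<tau> ''M'' = 2 ^ j"])
      (auto simp: less_Suc_eq)
  then show "j < regs \<sigma> ''W'' \<Longrightarrow> arrays (sem pow_prog \<sigma>) ''pw'' j = 2 ^ j"
    "regs (sem pow_prog \<sigma>) ''M'' = 2 ^ regs \<sigma> ''W''"
    by (simp_all add: pow_prog_def)
qed

lemma sem_shift_prog:
  assumes "regs \<sigma> ''j'' \<le> regs \<sigma> ''W''"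
  shows "regs (sem shift_prog \<sigma>) ''x'' = regs \<sigma> ''m'' div 2 ^ regs \<sigma> ''j''"
proof -
  let ?body = "LIf (Minus (Reg ''j'') (Reg ''q'')) (LAssign ''x'' (Half (Reg ''x''))) LSkip"
  let ?\<sigma> = "set_reg ''x'' (regs \<sigma> ''m'') \<sigma>"
  have "regs (sem (LFor ''q'' ''W'' ?body) ?\<sigma>) ''x'' = regs \<sigma> ''m'' div 2 ^ regs \<sigma> ''j''"
  proof (rule sem_LFor_induct[where P = "\<lambda>i \<tau>. regs \<tau> ''x'' = regs \<sigma> ''m'' div 2 ^ min i (regs \<sigma> ''j'')"])
    fix i \<tau> assume *: "regs \<tau> ''x'' = regs \<sigma> ''m'' div 2 ^ min i (regs \<sigma> ''j'')"
      and ag: "agree (LFor ''q'' ''W'' ?body) ?\<sigma> \<tau>"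
    have j: "regs \<tau> ''j'' = regs \<sigma> ''j''" using agree_regs[OF ag, of "''j''"] by simp
    show "regs (sem ?body (set_reg ''q'' i \<tau>)) ''x'' = regs \<sigma> ''m'' div 2 ^ min (Suc i) (regs \<sigma> ''j'')"
    proof (cases "i < regs \<sigma> ''j''")
      case True
      then show ?thesis using * j by (simp add: min_def div_mult2_eq mult.commute[of 2])
    next
      case False
      then show ?thesis using * j by (simp add: min_def)
    qed
  qed (use assms in \<open>auto simp: min_def\<close>)
  then show ?thesis by (simp add: shift_prog_def)
qed

lemma radix_inj: "c < B \<Longrightarrow> c' < B \<Longrightarrow> a * B + c = a' * B + c' \<longleftrightarrow> a = a' \<and> c = c'" for a c B :: nat
proof
  assume "c < B" "c' < B" "a * B + c = a' * B + c'"
  then have "(a * B + c) div B = (a' * B + c') div B" "(a * B + c) mod B = (a' * B + c') mod B" by simp_all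
  with \<open>c < B\<close> \<open>c' < B\<close> show "a = a' \<and> c = c'" by simp
qed simp

locale spd_prog =
  fixes n s t b :: nat and S :: "nat set" and R :: "(nat \<times> nat) set"
  assumes s: "s < n" and t: "t < n" and R: "R \<subseteq> {..<n} \<times> {..<n}"
begin

abbreviation Mx :: nat where "Mx \<equiv> 2 ^ Suc (4 * b)"
abbreviation Kx :: nat where "Kx \<equiv> n + b + 1"
abbreviation xs :: "nat list" where "xs \<equiv> layered_tokens R s S n Kx"

sublocale token_dp R s t b xs .

text \<open>Together with \<open>base_arrays\<close>, all that \<open>base\<close> speaks about; its
  preservation thus reduces to disjointness from write sets.\<close>

definition base_regs :: "string set" where
  "base_regs = {''n'', ''s'', ''t'', ''b1'', ''w'', ''W'', ''K'', ''n4'', ''M'', ''nn'', ''Z''}"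

definition base_arrays :: "string set" where
  "base_arrays = {''in'', ''pw'', ''rn'', ''rnn'', ''rm'', ''rv'', ''ri''}"

definition base :: "state \<Rightarrow> bool" where
  "base \<sigma> \<longleftrightarrow>
     regs \<sigma> ''n'' = n \<and> regs \<sigma> ''s'' = s \<and> regs \<sigma> ''t'' = t \<and> regs \<sigma> ''b1'' = b + 1 \<and> regs \<sigma> ''w'' = 2 * b \<and>
     regs \<sigma> ''W'' = Suc (4 * b) \<and> regs \<sigma> ''K'' = Kx \<and> regs \<sigma> ''n4'' = n + 4 \<and> regs \<sigma> ''M'' = Mx \<and>
     regs \<sigma> ''nn'' = n * n \<and> regs \<sigma> ''Z'' = n * (Mx * (b + 1)) \<and>
     (\<forall>u<n. \<forall>v<n. arrays \<sigma> ''in'' (n + 4 + (u * n + v)) \<noteq> 0 \<longleftrightarrow> (u, v) \<in> R) \<and>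
     (\<forall>v<n. arrays \<sigma> ''in'' (v + 4) \<noteq> 0 \<longleftrightarrow> v \<in> S) \<and>
     (\<forall>j<Suc (4 * b). arrays \<sigma> ''pw'' j = 2 ^ j) \<and>
     (\<forall>u<n. arrays \<sigma> ''rn'' u = u * n) \<and>
     (\<forall>k<Kx. arrays \<sigma> ''rnn'' k = k * (n * n)) \<and>
     (\<forall>m<Mx. arrays \<sigma> ''rm'' m = m * (b + 1)) \<and>
     (\<forall>v<n. arrays \<sigma> ''rv'' v = v * (Mx * (b + 1))) \<and>
     (\<forall>i<n. arrays \<sigma> ''ri'' i = i * (n * (Mx * (b + 1))))"

lemma base_cong:
  assumes "base \<sigma>" "\<And>r. r \<in> base_regs \<Longrightarrow> regs \<tau> r = regs \<sigma> r" "\<And>m. m \<in> base_arrays \<Longrightarrow> arrays \<tau> m = arrays \<sigma> m"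
  shows "base \<tau>"
  using assms unfolding base_def base_regs_def base_arrays_def by simp

lemma base_agree:
  assumes "base \<sigma>" "agree c \<sigma> \<tau>" "wr c \<inter> base_regs = {}" "wa c \<inter> base_arrays = {}"
  shows "base \<tau>"
  using assms(1)
proof (rule base_cong)
  show "regs \<tau> r = regs \<sigma> r" if "r \<in> base_regs" for r
    using that assms(3) by (intro agree_regs[OF assms(2)]) auto
  show "arrays \<tau> m = arrays \<sigma> m" if "m \<in> base_arrays" for m
    using that assms(4) by (intro agree_arrays[OF assms(2)]) auto
qed

lemma aval_adj:
  "base \<sigma> \<Longrightarrow> regs \<sigma> u < n \<Longrightarrow> regs \<sigma> v < n \<Longrightarrow> aval (adj u v) \<sigma> \<noteq> 0 \<longleftrightarrow> (regs \<sigma> u, regs \<sigma> v) \<in> R"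
  unfolding base_def adj_def by simp

section \<open>The table of walks by exact length\<close>

definition wadr :: "nat \<Rightarrow> nat \<Rightarrow> nat \<Rightarrow> nat" where
  "wadr k u v = (k * n + u) * n + v"

text \<open>\<open>k\<close> is the leading digit in base \<open>n\<close> and needs no bound, so
  even the layer written beyond the last one read has addresses of its own.\<close>

lemma wadr_inj: "u < n \<Longrightarrow> v < n \<Longrightarrow> u' < n \<Longrightarrow> v' < n \<Longrightarrow> wadr k u v = wadr k' u' v' \<longleftrightarrow> k = k' \<and> u = u' \<and> v = v'"
  by (simp add: wadr_def radix_inj)

lemma aval_walk_addr:
  assumes "base \<sigma>" "aval k \<sigma> = kv * (n * n)" "aval u \<sigma> < n"
  shows "aval (walk_addr k u v) \<sigma> = wadr kv (aval u \<sigma>) (aval v \<sigma>)"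
  using assms by (simp add: base_def walk_addr_def wadr_def algebra_simps)

text \<open>Holds in every intermediate state, even for the layer under construction, whereas
  \<open>walks_upto\<close> advances by one layer per pass of the outer loop.\<close>

definition walks_sound :: "state \<Rightarrow> bool" where
  "walks_sound \<sigma> \<longleftrightarrow> (\<forall>k u v. u < n \<longrightarrow> v < n \<longrightarrow> arrays \<sigma> ''wk'' (wadr k u v) \<noteq> 0 \<longrightarrow> (u, v) \<in> R ^^ k)"

definition walks_upto :: "nat \<Rightarrow> state \<Rightarrow> bool" where
  "walks_upto j \<sigma> \<longleftrightarrow> (\<forall>k u v. k < j \<longrightarrow> u < n \<longrightarrow> v < n \<longrightarrow> (u, v) \<in> R ^^ k \<longrightarrow> arrays \<sigma> ''wk'' (wadr k u v) \<noteq> 0)"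

text \<open>The preorder given to \<open>sem_nest\<close>: entries never disappear, and soundness
  persists.\<close>

definition walks_le :: "state \<Rightarrow> state \<Rightarrow> bool" where
  "walks_le \<sigma> \<tau> \<longleftrightarrow> (\<forall>a. arrays \<sigma> ''wk'' a \<noteq> 0 \<longrightarrow> arrays \<tau> ''wk'' a \<noteq> 0) \<and> (walks_sound \<sigma> \<longrightarrow> walks_sound \<tau>)"

lemma sem_walk_body:
  assumes "base \<sigma>" "regs \<sigma> ''k'' < Kx" "regs \<sigma> ''u'' < n" "regs \<sigma> ''v'' < n" "regs \<sigma> ''x'' < n"
  shows "sem walk_body \<sigma> =
    (if arrays \<sigma> ''wk'' (wadr (regs \<sigma> ''k'') (regs \<sigma> ''u'') (regs \<sigma> ''v'')) \<noteq> 0 \<and> (regs \<sigma> ''v'', regs \<sigma> ''x'') \<in> R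
     then set_cell ''wk'' (wadr (Suc (regs \<sigma> ''k'')) (regs \<sigma> ''u'') (regs \<sigma> ''x'')) 1 \<sigma> else \<sigma>)"
proof -
  have k: "aval (Load ''rnn'' (Reg ''k'')) \<sigma> = regs \<sigma> ''k'' * (n * n)"
    "aval (Plus (Load ''rnn'' (Reg ''k'')) (Reg ''nn'')) \<sigma> = Suc (regs \<sigma> ''k'') * (n * n)"
    using assms by (simp_all add: base_def)
  show ?thesis
    unfolding walk_body_def using aval_adj[OF assms(1,4,5)] assms
      aval_walk_addr[OF assms(1) k(1), of "Reg ''u''" "Reg ''v''"]
      aval_walk_addr[OF assms(1) k(2), of "Reg ''u''" "Reg ''x''"]
    by simp
qed

lemma walk_body_le:
  assumes "base \<sigma>" "regs \<sigma> ''k'' < Kx" "regs \<sigma> ''u'' < n" "regs \<sigma> ''v'' < n" "regs \<sigma> ''x'' < n"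
  shows "walks_le \<sigma> (sem walk_body \<sigma>)"
proof -
  have "walks_sound (sem walk_body \<sigma>)" if "walks_sound \<sigma>"
    using that assms unfolding sem_walk_body[OF assms] walks_sound_def
    by (auto simp: wadr_inj)
  then show ?thesis unfolding walks_le_def by (auto simp: sem_walk_body[OF assms])
qed

text \<open>A walk of length \<open>k + 1\<close> splits off its last arc \<open>(v, x)\<close>;
  \<open>sem_nest\<close> supplies a moment at which \<open>u\<close>, \<open>v\<close>,
  \<open>x\<close> are the loop values, and the entry for the first \<open>k\<close> steps is
  present then.\<close>

lemma walk_nest:
  assumes "base \<sigma>" "regs \<sigma> ''k'' = k" "k < Kx" "walks_sound \<sigma>" "walks_upto (Suc k) \<sigma>"
  defines "nst \<equiv> nest [(''u'', ''n''), (''v'', ''n''), (''x'', ''n'')] walk_body"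
  shows "walks_sound (sem nst \<sigma>)" "walks_upto (Suc (Suc k)) (sem nst \<sigma>)"
proof -
  have fr: "base \<tau> \<and> regs \<tau> ''k'' = k" if "agree nst \<sigma> \<tau>" for \<tau>
    using base_agree[OF assms(1) that] agree_regs[OF that, of "''k''"] assms(2)
    by (simp add: nst_def base_regs_def base_arrays_def)
  have reg_n: "regs \<sigma> ''n'' = n" using assms(1) by (simp add: base_def)
  have nst: "walks_le \<sigma> (sem nst \<sigma>) \<and>
    (\<forall>vs. list_all2 (\<lambda>v x. v < regs \<sigma> (snd x)) vs [(''u'', ''n''), (''v'', ''n''), (''x'', ''n'')] \<longrightarrow>
      (\<exists>\<tau>. agree nst \<sigma> \<tau> \<and> walks_le \<sigma> \<tau> \<and> walks_le (sem walk_body \<tau>) (sem nst \<sigma>) \<and>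
         map (regs \<tau> \<circ> fst) [(''u'', ''n''), (''v'', ''n''), (''x'', ''n'')] = vs))"
    unfolding nst_def
  proof (rule sem_nest)
    fix \<tau> assume ag: "agree (nest [(''u'', ''n''), (''v'', ''n''), (''x'', ''n'')] walk_body) \<sigma> \<tau>"
      and lt: "\<And>r N. (r, N) \<in> set [(''u'', ''n''), (''v'', ''n''), (''x'', ''n'')] \<Longrightarrow> regs \<tau> r < regs \<sigma> N"
    show "walks_le \<tau> (sem walk_body \<tau>)"
      using fr[unfolded nst_def, OF ag] assms(3) lt[of "''u''" "''n''"] lt[of "''v''" "''n''"] lt[of "''x''" "''n''"]
      by (intro walk_body_le) (simp_all add: reg_n)
  qed (auto simp: walks_le_def walks_sound_def)
  then show "walks_sound (sem nst \<sigma>)" using assms(4) by (simp add: walks_le_def)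
  show "walks_upto (Suc (Suc k)) (sem nst \<sigma>)"
    unfolding walks_upto_def
  proof (intro allI impI)
    fix k' u x assume k': "k' < Suc (Suc k)" "u < n" "x < n" "(u, x) \<in> R ^^ k'"
    show "arrays (sem nst \<sigma>) ''wk'' (wadr k' u x) \<noteq> 0"
    proof (cases "k' = Suc k")
      case False
      then have "k' < Suc k" using k'(1) by simp
      then have "arrays \<sigma> ''wk'' (wadr k' u x) \<noteq> 0" using assms(5) k' unfolding walks_upto_def by blast
      then show ?thesis using nst unfolding walks_le_def by blast
    next
      case True
      then obtain v where v: "(u, v) \<in> R ^^ k" "(v, x) \<in> R" using k'(4) by auto
      then have "v < n" using R by auto
      with k' reg_n have "list_all2 (\<lambda>v x. v < regs \<sigma> (snd x)) [u, v, x] [(''u'', ''n''), (''v'', ''n''), (''x'', ''n'')]"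
        by simp
      from mp[OF spec[OF conjunct2[OF nst]] this]
      obtain \<tau> where \<tau>: "agree nst \<sigma> \<tau>" "walks_le \<sigma> \<tau>" "walks_le (sem walk_body \<tau>) (sem nst \<sigma>)"
        "map (regs \<tau> \<circ> fst) [(''u'', ''n''), (''v'', ''n''), (''x'', ''n'')] = [u, v, x]"
        by (elim exE conjE)
      have "arrays \<sigma> ''wk'' (wadr k u v) \<noteq> 0" using assms(5) v k' \<open>v < n\<close> unfolding walks_upto_def by blast
      then have "arrays \<tau> ''wk'' (wadr k u v) \<noteq> 0" using \<tau>(2) unfolding walks_le_def by blast
      then have "arrays (sem walk_body \<tau>) ''wk'' (wadr (Suc k) u x) \<noteq> 0"
        using fr[OF \<tau>(1)] \<tau>(4) assms(3) k' \<open>v < n\<close> v by (subst sem_walk_body) simp_all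
      then show ?thesis using \<tau>(3) True unfolding walks_le_def by blast
    qed
  qed
qed

definition walks_ok :: "state \<Rightarrow> bool" where
  "walks_ok \<sigma> \<longleftrightarrow> (\<forall>k u v. k < Kx \<longrightarrow> u < n \<longrightarrow> v < n \<longrightarrow> (arrays \<sigma> ''wk'' (wadr k u v) \<noteq> 0 \<longleftrightarrow> (u, v) \<in> R ^^ k))"

lemma sem_walk_prog:
  assumes "base \<sigma>" "\<And>a. arrays \<sigma> ''wk'' a = 0"
  shows "walks_ok (sem walk_prog \<sigma>)"
proof -
  let ?init = "LFor ''u'' ''n'' (LStore ''wk'' (walk_addr (Const 0) (Reg ''u'') (Reg ''u'')) (Const 1))"
  let ?nst = "nest [(''u'', ''n''), (''v'', ''n''), (''x'', ''n'')] walk_body"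
  define \<sigma>1 where "\<sigma>1 = sem ?init \<sigma>"
  have ag1: "agree ?init \<sigma> \<sigma>1" unfolding \<sigma>1_def by (rule agree_sem)
  have base1: "base \<sigma>1"
    by (rule base_agree[OF assms(1) ag1]) (simp_all add: base_regs_def base_arrays_def)
  have reg_n: "regs \<sigma> ''n'' = n" using assms(1) by (simp add: base_def)
  have init: "walks_sound \<sigma>1 \<and> walks_upto (Suc 0) \<sigma>1"
    unfolding \<sigma>1_def
  proof (rule sem_LFor_induct[where P = "\<lambda>i \<tau>. walks_sound \<tau> \<and> (\<forall>u<i. arrays \<tau> ''wk'' (wadr 0 u u) \<noteq> 0)"])
    show "walks_sound \<sigma> \<and> (\<forall>u<0. arrays \<sigma> ''wk'' (wadr 0 u u) \<noteq> 0)"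
      using assms(2) by (simp add: walks_sound_def)
  next
    fix i \<tau> assume i: "i < regs \<sigma> ''n''" and P: "walks_sound \<tau> \<and> (\<forall>u<i. arrays \<tau> ''wk'' (wadr 0 u u) \<noteq> 0)"
      and ag: "agree ?init \<sigma> \<tau>"
    let ?\<tau> = "set_reg ''u'' i \<tau>"
    have "base ?\<tau>"
      by (rule base_agree[OF assms(1) agree_set_reg[OF ag]]) (simp_all add: base_regs_def base_arrays_def)
    then have "aval (walk_addr (Const 0) (Reg ''u'') (Reg ''u'')) ?\<tau> = wadr 0 i i"
      using i reg_n by (subst aval_walk_addr[where kv = 0]) simp_all
    then show "walks_sound (sem (LStore ''wk'' (walk_addr (Const 0) (Reg ''u'') (Reg ''u'')) (Const 1)) ?\<tau>) \<and>
      (\<forall>u<Suc i. arrays (sem (LStore ''wk'' (walk_addr (Const 0) (Reg ''u'') (Reg ''u'')) (Const 1)) ?\<tau>) ''wk'' (wadr 0 u u) \<noteq> 0)"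
      using P i reg_n by (auto simp: walks_sound_def wadr_inj less_Suc_eq)
  next
    fix \<tau> assume "walks_sound \<tau> \<and> (\<forall>u<regs \<sigma> ''n''. arrays \<tau> ''wk'' (wadr 0 u u) \<noteq> 0)"
    then show "walks_sound (set_reg ''u'' (regs \<sigma> ''n'') \<tau>) \<and> walks_upto (Suc 0) (set_reg ''u'' (regs \<sigma> ''n'') \<tau>)"
      using reg_n by (auto simp: walks_sound_def walks_upto_def)
  qed
  have regK: "regs \<sigma>1 ''K'' = Kx" using base1 by (simp add: base_def)
  have "walks_sound (sem (LFor ''k'' ''K'' ?nst) \<sigma>1) \<and> walks_upto (Suc Kx) (sem (LFor ''k'' ''K'' ?nst) \<sigma>1)"
  proof (rule sem_LFor_induct[where P = "\<lambda>i \<tau>. walks_sound \<tau> \<and> walks_upto (Suc i) \<tau>"])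
    show "walks_sound \<sigma>1 \<and> walks_upto (Suc 0) \<sigma>1" by (rule init)
  next
    fix k \<tau> assume k: "k < regs \<sigma>1 ''K''" and P: "walks_sound \<tau> \<and> walks_upto (Suc k) \<tau>"
      and ag: "agree (LFor ''k'' ''K'' ?nst) \<sigma>1 \<tau>"
    let ?\<tau> = "set_reg ''k'' k \<tau>"
    have "base ?\<tau>"
      by (rule base_agree[OF base1 agree_set_reg[OF ag]]) (simp_all add: base_regs_def base_arrays_def)
    moreover have "walks_sound ?\<tau>" "walks_upto (Suc k) ?\<tau>" using P by (simp_all add: walks_sound_def walks_upto_def)
    ultimately show "walks_sound (sem ?nst ?\<tau>) \<and> walks_upto (Suc (Suc k)) (sem ?nst ?\<tau>)"
      using walk_nest[of ?\<tau> k] k regK by simp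
  qed (use regK in \<open>simp_all add: walks_sound_def walks_upto_def\<close>)
  moreover have "walks_ok \<tau>" if "walks_sound \<tau> \<and> walks_upto (Suc Kx) \<tau>" for \<tau>
    using that unfolding walks_ok_def walks_sound_def walks_upto_def by (meson less_SucI)
  ultimately have "walks_ok (sem (LFor ''k'' ''K'' ?nst) \<sigma>1)" by blast
  then show ?thesis unfolding walk_prog_def \<sigma>1_def sem.simps(4) .
qed

text \<open>The array \<open>tok\<close> is shifted by \<open>2b\<close>, so that cell \<open>i + j\<close> belongs to bit \<open>j\<close> at path vertex \<open>i\<close>, and it
  stores successors, so that \<open>0\<close> marks a missing token.\<close>

definition tokens_ok :: "nat list \<Rightarrow> state \<Rightarrow> bool" where
  "tokens_ok ys \<sigma> \<longleftrightarrow> regs \<sigma> ''cnt'' = length ys \<and>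
     (\<forall>q. arrays \<sigma> ''tok'' q = (if 2 * b \<le> q \<and> q < 2 * b + length ys then Suc (ys ! (q - 2 * b)) else 0)) \<and>
     (\<forall>v. arrays \<sigma> ''placed'' v = (if v \<in> set ys then 1 else 0))"

lemma tokens_ok_set_reg [simp]: "r \<noteq> ''cnt'' \<Longrightarrow> tokens_ok ys (set_reg r i \<tau>) = tokens_ok ys \<tau>"
  by (simp add: tokens_ok_def)

lemma tokens_ok_snoc:
  assumes "tokens_ok ys \<sigma>"
  shows "tokens_ok (ys @ [v]) (set_reg ''cnt'' (Suc (length ys))
    (set_cell ''tok'' (2 * b + length ys) (Suc v) (set_cell ''placed'' v 1 \<sigma>)))"
  using assms by (auto simp: tokens_ok_def nth_append)

lemma sem_token_prog:
  assumes "base \<sigma>" "walks_ok \<sigma>" "tokens_ok [] \<sigma>"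
  shows "tokens_ok xs (sem token_prog \<sigma>)"
  unfolding token_prog_def
proof (rule sem_LFor_induct[where P = "\<lambda>k. tokens_ok (layered_tokens R s S n k)"])
  have regK: "regs \<sigma> ''K'' = Kx" using assms(1) by (simp add: base_def)
  show "tokens_ok (layered_tokens R s S n 0) \<sigma>" using assms(3) by (simp add: layered_tokens_def)
  show "tokens_ok xs (set_reg ''k'' (regs \<sigma> ''K'') \<tau>)" if "tokens_ok (layered_tokens R s S n (regs \<sigma> ''K'')) \<tau>" for \<tau>
    using that regK by simp
  fix k \<tau> assume k: "k < regs \<sigma> ''K''" and P: "tokens_ok (layered_tokens R s S n k) \<tau>"
    and ag: "agree (LFor ''k'' ''K'' (LFor ''v'' ''n'' token_body)) \<sigma> \<tau>"
  let ?\<tau> = "set_reg ''k'' k \<tau>"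
  let ?F = "\<lambda>j. filter (\<lambda>v. v \<in> S \<and> layer R s v k) [0..<j]"
  have ag': "agree (LFor ''k'' ''K'' (LFor ''v'' ''n'' token_body)) \<sigma> ?\<tau>"
    using ag by (rule agree_set_reg) simp
  have base: "base ?\<tau>"
    by (rule base_agree[OF assms(1) ag']) (simp_all add: base_regs_def base_arrays_def)
  have wk: "arrays ?\<tau> ''wk'' = arrays \<sigma> ''wk''" by (rule agree_arrays[OF ag']) simp
  have regn: "regs ?\<tau> ''n'' = n" using base by (simp add: base_def)
  show "tokens_ok (layered_tokens R s S n (Suc k)) (sem (LFor ''v'' ''n'' token_body) ?\<tau>)"
  proof (rule sem_LFor_induct[where P = "\<lambda>j. tokens_ok (layered_tokens R s S n k @ ?F j)"])
    show "tokens_ok (layered_tokens R s S n k @ ?F 0) ?\<tau>" using P by simp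
    show "tokens_ok (layered_tokens R s S n (Suc k)) (set_reg ''v'' (regs ?\<tau> ''n'') \<rho>)"
      if "tokens_ok (layered_tokens R s S n k @ ?F (regs ?\<tau> ''n'')) \<rho>" for \<rho>
      using that regn by (simp add: layered_tokens_Suc)
    fix v \<rho> assume v: "v < regs ?\<tau> ''n''" and Q: "tokens_ok (layered_tokens R s S n k @ ?F v) \<rho>"
      and agv: "agree (LFor ''v'' ''n'' token_body) ?\<tau> \<rho>"
    let ?\<rho> = "set_reg ''v'' v \<rho>" and ?ys = "layered_tokens R s S n k @ ?F v"
    have agv': "agree (LFor ''v'' ''n'' token_body) ?\<tau> ?\<rho>"
      using agv by (rule agree_set_reg) simp
    have base': "base ?\<rho>"
      by (rule base_agree[OF base agv']) (simp_all add: base_regs_def base_arrays_def)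
    have wk': "arrays ?\<rho> ''wk'' = arrays \<sigma> ''wk''" using agree_arrays[OF agv', of "''wk''"] wk by simp
    have "regs ?\<rho> ''k'' = regs ?\<tau> ''k''" by (rule agree_regs[OF agv']) simp
    then have rk: "regs ?\<rho> ''k'' = k" by simp
    have rs: "regs ?\<rho> ''s'' = s" using base' by (simp add: base_def)
    have kx: "k < Kx" and vn: "v < n" using k regK v regn by simp_all
    have "aval (Load ''rnn'' (Reg ''k'')) ?\<rho> = k * (n * n)" using base' rk kx by (simp add: base_def)
    from aval_walk_addr[OF base' this, of "Reg ''s''" "Reg ''v''"]
    have addr: "aval (walk_addr (Load ''rnn'' (Reg ''k'')) (Reg ''s'') (Reg ''v'')) ?\<rho> = wadr k s v"
      using rs s by simp
    have inS: "arrays ?\<rho> ''in'' (v + 4) \<noteq> 0 \<longleftrightarrow> v \<in> S" using base' vn unfolding base_def by blast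
    have wkv: "arrays ?\<rho> ''wk'' (wadr k s v) \<noteq> 0 \<longleftrightarrow> (s, v) \<in> R ^^ k"
      unfolding wk' using assms(2) kx s vn by (simp add: walks_ok_def)
    have tk: "tokens_ok ?ys ?\<rho>" using Q by simp
    then have pl: "arrays ?\<rho> ''placed'' v = (if v \<in> set ?ys then 1 else 0)" by (simp add: tokens_ok_def)
    \<comment> \<open>\<open>?F v\<close> contains only vertices below \<open>v\<close>, so
      \<open>v\<close> can have been placed only in an earlier layer.\<close>
    have "v \<in> set ?ys \<longleftrightarrow> v \<in> S \<and> (\<exists>k'<k. (s, v) \<in> R ^^ k')" using vn by (auto simp: set_layered_tokens)
    then have cond: "v \<in> S \<and> (s, v) \<in> R ^^ k \<and> v \<notin> set ?ys \<longleftrightarrow> v \<in> S \<and> layer R s v k"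
      by (auto simp: layer_def)
    have sem: "sem token_body ?\<rho> = (if v \<in> S \<and> (s, v) \<in> R ^^ k \<and> v \<notin> set ?ys
      then set_reg ''cnt'' (Suc (length ?ys)) (set_cell ''tok'' (2 * b + length ?ys) (Suc v) (set_cell ''placed'' v 1 ?\<rho>))
      else ?\<rho>)"
    proof -
      have g: "(\<forall>a \<in> set [Load ''in'' (Plus (Reg ''v'') (Const 4)),
          Load ''wk'' (walk_addr (Load ''rnn'' (Reg ''k'')) (Reg ''s'') (Reg ''v'')),
          Minus (Const 1) (Load ''placed'' (Reg ''v''))]. aval a ?\<rho> \<noteq> 0)
        \<longleftrightarrow> v \<in> S \<and> (s, v) \<in> R ^^ k \<and> v \<notin> set ?ys"
        using inS wkv pl addr by auto
      have "regs ?\<rho> ''cnt'' = length ?ys" "regs ?\<rho> ''w'' = 2 * b"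
        using tk base' by (simp_all add: tokens_ok_def base_def)
      then show ?thesis unfolding token_body_def sem_guard g by simp
    qed
    show "tokens_ok (layered_tokens R s S n k @ ?F (Suc v)) (sem token_body ?\<rho>)"
    proof (cases "v \<in> S \<and> layer R s v k")
      case False
      then have "sem token_body ?\<rho> = ?\<rho>" unfolding sem cond by (rule if_not_P)
      moreover have "?F (Suc v) = ?F v" using False by auto
      ultimately show ?thesis using tk by simp
    next
      case True
      then have "layered_tokens R s S n k @ ?F (Suc v) = ?ys @ [v]" by simp
      then show ?thesis using True tokens_ok_snoc[OF tk, of v] unfolding sem cond by simp
    qed
  qed
qed

section \<open>The table of dynamic programming states\<close>

definition sadr :: "nat \<Rightarrow> nat \<Rightarrow> nat \<Rightarrow> nat \<Rightarrow> nat" where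
  "sadr i v m c = ((i * n + v) * Mx + m) * (b + 1) + c"

lemma sadr_inj:
  "v < n \<Longrightarrow> m < Mx \<Longrightarrow> c \<le> b \<Longrightarrow> v' < n \<Longrightarrow> m' < Mx \<Longrightarrow> c' \<le> b \<Longrightarrow>
    sadr i v m c = sadr i' v' m' c' \<longleftrightarrow> i = i' \<and> v = v' \<and> m = m' \<and> c = c'"
  unfolding sadr_def by (subst radix_inj, simp, simp, subst radix_inj, simp, simp, subst radix_inj) auto

definition accept_at :: "nat \<Rightarrow> bool" where
  "accept_at i \<longleftrightarrow> (\<exists>m c j k. der i t m c \<and> assign i t m c j k \<and> Suc i = length xs)"

definition dp_sound :: "state \<Rightarrow> bool" where
  "dp_sound \<sigma> \<longleftrightarrow> (\<forall>i v m c. v < n \<longrightarrow> m < Mx \<longrightarrow> c \<le> b \<longrightarrow> arrays \<sigma> ''A'' (sadr i v m c) \<noteq> 0 \<longrightarrow> der i v m c) \<and>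
     regs \<sigma> ''out'' \<le> 1 \<and> (regs \<sigma> ''out'' \<noteq> 0 \<longrightarrow> accept)"

text \<open>Entries are complete up to level \<open>j\<close>, acceptance only below it: a state of
  level \<open>i\<close> is entered in pass \<open>i - 1\<close> (level 0 beforehand) and tested for
  acceptance in pass \<open>i\<close>.\<close>

definition dp_upto :: "nat \<Rightarrow> state \<Rightarrow> bool" where
  "dp_upto j \<sigma> \<longleftrightarrow> (\<forall>i v m c. i \<le> j \<longrightarrow> der i v m c \<longrightarrow> arrays \<sigma> ''A'' (sadr i v m c) \<noteq> 0) \<and>
     (\<forall>i<j. accept_at i \<longrightarrow> regs \<sigma> ''out'' \<noteq> 0)"

text \<open>The analogue of \<open>walks_le\<close>, with the answer register treated like a further
  entry.\<close>

definition dp_le :: "state \<Rightarrow> state \<Rightarrow> bool" where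
  "dp_le \<sigma> \<tau> \<longleftrightarrow> (\<forall>a. arrays \<sigma> ''A'' a \<noteq> 0 \<longrightarrow> arrays \<tau> ''A'' a \<noteq> 0) \<and>
     (regs \<sigma> ''out'' \<noteq> 0 \<longrightarrow> regs \<tau> ''out'' \<noteq> 0) \<and> (dp_sound \<sigma> \<longrightarrow> dp_sound \<tau>)"

definition dp_ready :: "state \<Rightarrow> bool" where
  "dp_ready \<sigma> \<longleftrightarrow> base \<sigma> \<and> walks_ok \<sigma> \<and> regs \<sigma> ''cnt'' = length xs \<and>
     (\<forall>q. arrays \<sigma> ''tok'' q = (if 2 * b \<le> q \<and> q < 2 * b + length xs then Suc (xs ! (q - 2 * b)) else 0))"

lemma dp_ready_agree:
  assumes "dp_ready \<sigma>" "agree c \<sigma> \<tau>" "wr c \<inter> insert ''cnt'' base_regs = {}" "wa c \<inter> {''wk'', ''tok''} \<union> wa c \<inter> base_arrays = {}"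
  shows "dp_ready \<tau>"
proof -
  have "base \<tau>" by (rule base_agree[OF _ assms(2)]) (use assms in \<open>auto simp: dp_ready_def\<close>)
  moreover have "regs \<tau> ''cnt'' = regs \<sigma> ''cnt''" by (rule agree_regs[OF assms(2)]) (use assms(3) in auto)
  moreover have "arrays \<tau> ''wk'' = arrays \<sigma> ''wk''" by (rule agree_arrays[OF assms(2)]) (use assms(4) in auto)
  moreover have "arrays \<tau> ''tok'' = arrays \<sigma> ''tok''" by (rule agree_arrays[OF assms(2)]) (use assms(4) in auto)
  ultimately show ?thesis using assms(1) by (simp add: dp_ready_def walks_ok_def)
qed

lemma aval_state_addr:
  assumes "base \<sigma>" "aval i \<sigma> = iv * (n * (Mx * (b + 1)))" "aval v \<sigma> < n" "aval m \<sigma> < Mx"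
  shows "aval (state_addr i v m c) \<sigma> = sadr iv (aval v \<sigma>) (aval m \<sigma>) (aval c \<sigma>)"
proof -
  have "arrays \<sigma> ''rv'' (aval v \<sigma>) = aval v \<sigma> * (Mx * (b + 1))" "arrays \<sigma> ''rm'' (aval m \<sigma>) = aval m \<sigma> * (b + 1)"
    using assms(1,3,4) unfolding base_def by blast+
  then show ?thesis unfolding state_addr_def sadr_def aval.simps assms(2) by (simp only: algebra_simps)
qed

lemma der_lt: "der i v m c \<Longrightarrow> v < n \<and> m < Mx \<and> c \<le> b"
  using der_bounds[of i v m c] der_range[of i v m c] s R by auto


lemma sem_dp_update:
  assumes rdy: "dp_ready \<sigma>" and i: "regs \<sigma> ''i'' = i" "i < n" and v: "regs \<sigma> ''v'' = v" "v < n"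
    and m: "regs \<sigma> ''m'' = m" "m < Mx" and c: "regs \<sigma> ''c'' = c" "c \<le> b"
    and j: "regs \<sigma> ''j'' = j" "j < Suc (4 * b)" and k: "regs \<sigma> ''k'' = k" "k < Kx"
    and y: "regs \<sigma> ''y'' = y" "y < n" and x: "regs \<sigma> ''x'' = m div 2 ^ j"
  shows "sem dp_update \<sigma> =
    (if arrays \<sigma> ''A'' (sadr i v m c) \<noteq> 0 \<and> assign i v m c j k then
       let \<sigma>1 = (if (v, y) \<in> R then set_cell ''A'' (sadr (Suc i) y ((m + 2 ^ j) div 2) (c + k)) 1 \<sigma> else \<sigma>)
       in if Suc i = length xs \<and> v = t then set_reg ''out'' 1 \<sigma>1 else \<sigma>1
     else \<sigma>)"
proof -
  let ?a1 = "Load ''A'' (state_addr (Load ''ri'' (Reg ''i'')) (Reg ''v'') (Reg ''m'') (Reg ''c''))"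
  let ?a2 = "eqx (Reg ''x'') (Plus (Half (Reg ''x'')) (Half (Reg ''x'')))"
  let ?a3 = "Load ''tok'' (Plus (Reg ''i'') (Reg ''j''))"
  let ?wa = "walk_addr (Load ''rnn'' (Reg ''k'')) (Minus ?a3 (Const 1)) (Reg ''v'')"
  let ?a5 = "Minus (Reg ''b1'') (Plus (Reg ''c'') (Reg ''k''))"
  let ?ta = "state_addr (Plus (Load ''ri'' (Reg ''i'')) (Reg ''Z'')) (Reg ''y'')
            (Half (Plus (Reg ''m'') (Load ''pw'' (Reg ''j'')))) (Plus (Reg ''c'') (Reg ''k''))"
  let ?q = "i + j - 2 * b"
  have base: "base \<sigma>" and wk: "walks_ok \<sigma>" and cnt: "regs \<sigma> ''cnt'' = length xs"
    and tok: "arrays \<sigma> ''tok'' (i + j) = (if 2 * b \<le> i + j \<and> i + j < 2 * b + length xs then Suc (xs ! ?q) else 0)"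
    using rdy unfolding dp_ready_def by blast+
  have b1: "regs \<sigma> ''b1'' = b + 1" and rt: "regs \<sigma> ''t'' = t" using base by (simp_all add: base_def)
  have ri: "aval (Load ''ri'' (Reg ''i'')) \<sigma> = i * (n * (Mx * (b + 1)))"
    and ri': "aval (Plus (Load ''ri'' (Reg ''i'')) (Reg ''Z'')) \<sigma> = Suc i * (n * (Mx * (b + 1)))"
    and rnn: "aval (Load ''rnn'' (Reg ''k'')) \<sigma> = k * (n * n)"
    and pw: "arrays \<sigma> ''pw'' j = 2 ^ j"
    using base i j k by (simp_all add: base_def)
  have g1: "aval ?a1 \<sigma> = arrays \<sigma> ''A'' (sadr i v m c)"
    using aval_state_addr[OF base ri, of "Reg ''v''" "Reg ''m''"] v m c by simp
  have half: "z = z div 2 + z div 2 \<longleftrightarrow> even z" for z :: nat by presburger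
  have g2: "aval ?a2 \<sigma> \<noteq> 0 \<longleftrightarrow> \<not> bit m j"
    using half[of "m div 2 ^ j"] by (simp add: x bit_iff_odd)
  have g3: "aval ?a3 \<sigma> \<noteq> 0 \<longleftrightarrow> 2 * b \<le> i + j \<and> ?q < length xs"
    using tok i j by auto
  \<comment> \<open>Only under the range condition does the cell hold the successor of a vertex;
    this is enough, as the condition is another member of the same conjunction.\<close>
  have g4: "aval (Load ''wk'' ?wa) \<sigma> \<noteq> 0 \<longleftrightarrow> (xs ! ?q, v) \<in> R ^^ k" if "2 * b \<le> i + j \<and> ?q < length xs"
  proof -
    have q: "aval (Minus ?a3 (Const 1)) \<sigma> = xs ! ?q" using that tok i j by auto
    have "xs ! ?q \<in> set xs" using that by (intro nth_mem) simp
    then have "xs ! ?q < n" unfolding set_layered_tokens by blast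
    then have "aval ?wa \<sigma> = wadr k (xs ! ?q) v"
      using aval_walk_addr[OF base rnn, of "Minus ?a3 (Const 1)"] v q by simp
    then show ?thesis using wk k v \<open>xs ! ?q < n\<close> by (simp add: walks_ok_def)
  qed
  have g5: "aval ?a5 \<sigma> \<noteq> 0 \<longleftrightarrow> c + k \<le> b" using b1 c k by auto
  have g: "(\<forall>a \<in> set [?a1, ?a2, ?a3, Load ''wk'' ?wa, ?a5]. aval a \<sigma> \<noteq> 0)
    \<longleftrightarrow> arrays \<sigma> ''A'' (sadr i v m c) \<noteq> 0 \<and> assign i v m c j k"
    unfolding assign_def set_simps ball_simps g1 g2 g3 g5 using g4 j(2) by blast
  have mx: "(m + 2 ^ j) div 2 < Mx" using m(2) j(2) by (rule shifted_mask_less)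
  have ta: "aval ?ta \<sigma> = sadr (Suc i) y ((m + 2 ^ j) div 2) (c + k)"
    using aval_state_addr[OF base ri', of "Reg ''y''" "Half (Plus (Reg ''m'') (Load ''pw'' (Reg ''j'')))"]
      y m j c k pw mx by simp
  have adj: "aval (adj ''v'' ''y'') \<sigma> \<noteq> 0 \<longleftrightarrow> (v, y) \<in> R" using aval_adj[OF base] v y by simp
  show ?thesis unfolding dp_update_def sem_guard g
    using adj ta cnt i v rt by (simp add: Let_def)
qed

lemma dp_update_le:
  assumes "dp_ready \<sigma>" "regs \<sigma> ''i'' < n" "regs \<sigma> ''v'' < n" "regs \<sigma> ''m'' < Mx" "regs \<sigma> ''c'' \<le> b"
    "regs \<sigma> ''j'' < Suc (4 * b)" "regs \<sigma> ''k'' < Kx" "regs \<sigma> ''y'' < n"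
    "regs \<sigma> ''x'' = regs \<sigma> ''m'' div 2 ^ regs \<sigma> ''j''"
  shows "dp_le \<sigma> (sem dp_update \<sigma>)"
proof -
  define i v m c j k y where "i = regs \<sigma> ''i''" "v = regs \<sigma> ''v''" "m = regs \<sigma> ''m''" "c = regs \<sigma> ''c''"
    "j = regs \<sigma> ''j''" "k = regs \<sigma> ''k''" "y = regs \<sigma> ''y''"
  note defs = this
  note sem = sem_dp_update[OF assms(1) defs(1)[symmetric] _ defs(2)[symmetric] _ defs(3)[symmetric] _
      defs(4)[symmetric] _ defs(5)[symmetric] _ defs(6)[symmetric] _ defs(7)[symmetric]]
  note sem = sem[unfolded defs, OF assms(2-9), folded defs]
  show ?thesis
  proof (cases "arrays \<sigma> ''A'' (sadr i v m c) \<noteq> 0 \<and> assign i v m c j k")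
    case False
    then have "sem dp_update \<sigma> = \<sigma>" unfolding sem by (rule if_not_P)
    then show ?thesis by (simp add: dp_le_def)
  next
    case True
    let ?\<sigma>1 = "if (v, y) \<in> R then set_cell ''A'' (sadr (Suc i) y ((m + 2 ^ j) div 2) (c + k)) 1 \<sigma> else \<sigma>"
    have eq: "sem dp_update \<sigma> = (if Suc i = length xs \<and> v = t then set_reg ''out'' 1 ?\<sigma>1 else ?\<sigma>1)"
      using True unfolding sem Let_def by (rule if_P)
    have "dp_sound (sem dp_update \<sigma>)" if snd: "dp_sound \<sigma>"
    proof -
      have der: "der i v m c" using snd True assms unfolding dp_sound_def defs by blast
      have der': "der (Suc i) y ((m + 2 ^ j) div 2) (c + k)" if "(v, y) \<in> R"
        using der_step[OF der] True that by blast
      have s1: "dp_sound ?\<sigma>1"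
      proof (cases "(v, y) \<in> R")
        case vy: True
        \<comment> \<open>The new state lies within the digit ranges, so a cell with the same
          address belongs to the same state.\<close>
        from der_lt[OF der'[OF this]] have bd: "y < n" "(m + 2 ^ j) div 2 < Mx" "c + k \<le> b" by auto
        have "der i' v' m' c'" if "v' < n" "m' < Mx" "c' \<le> b" "arrays ?\<sigma>1 ''A'' (sadr i' v' m' c') \<noteq> 0"
          for i' v' m' c'
        proof (cases "sadr i' v' m' c' = sadr (Suc i) y ((m + 2 ^ j) div 2) (c + k)")
          case True
          then show ?thesis using sadr_inj[OF that(1-3) bd] der'[OF vy] by simp
        next
          case False
          then show ?thesis using that snd vy unfolding dp_sound_def by auto
        qed
        moreover have "regs ?\<sigma>1 = regs \<sigma>" by simp
        ultimately show ?thesis using snd unfolding dp_sound_def by simp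
      qed (use snd in simp)
      have "accept" if "Suc i = length xs \<and> v = t"
        using that der True unfolding accept_def by blast
      with s1 show ?thesis unfolding eq by (simp add: dp_sound_def)
    qed
    then show ?thesis by (auto simp: dp_le_def eq)
  qed
qed

lemma sem_dp_body:
  assumes "dp_ready \<sigma>" "regs \<sigma> ''j'' < Suc (4 * b)"
  shows "\<exists>\<tau>. agree shift_prog \<sigma> \<tau> \<and> regs \<tau> ''x'' = regs \<sigma> ''m'' div 2 ^ regs \<sigma> ''j'' \<and> dp_ready \<tau> \<and>
    sem dp_body \<sigma> = sem dp_update \<tau> \<and> dp_le \<sigma> \<tau>"
proof (intro exI conjI)
  let ?\<tau> = "sem shift_prog \<sigma>"
  show ag: "agree shift_prog \<sigma> ?\<tau>" by (rule agree_sem)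
  have "regs \<sigma> ''W'' = Suc (4 * b)" using assms(1) by (simp add: dp_ready_def base_def)
  then show "regs ?\<tau> ''x'' = regs \<sigma> ''m'' div 2 ^ regs \<sigma> ''j''"
    using assms(2) by (intro sem_shift_prog) simp
  show "dp_ready ?\<tau>"
    by (rule dp_ready_agree[OF assms(1) ag]) (auto simp: base_regs_def base_arrays_def)
  show "sem dp_body \<sigma> = sem dp_update ?\<tau>" by (simp add: dp_body_def)
  show "dp_le \<sigma> ?\<tau>" by (simp add: dp_le_def dp_sound_def)
qed

lemma dp_le_trans: "dp_le \<sigma> \<tau> \<Longrightarrow> dp_le \<tau> \<rho> \<Longrightarrow> dp_le \<sigma> \<rho>"
  by (simp add: dp_le_def)

lemma dp_body_le:
  assumes "dp_ready \<sigma>" "regs \<sigma> ''i'' < n" "regs \<sigma> ''v'' < n" "regs \<sigma> ''m'' < Mx" "regs \<sigma> ''c'' \<le> b"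
    "regs \<sigma> ''j'' < Suc (4 * b)" "regs \<sigma> ''k'' < Kx" "regs \<sigma> ''y'' < n"
  shows "dp_le \<sigma> (sem dp_body \<sigma>)"
proof -
  from sem_dp_body[OF assms(1,6)] obtain \<tau> where \<tau>: "agree shift_prog \<sigma> \<tau>"
    "regs \<tau> ''x'' = regs \<sigma> ''m'' div 2 ^ regs \<sigma> ''j''" "dp_ready \<tau>"
    "sem dp_body \<sigma> = sem dp_update \<tau>" "dp_le \<sigma> \<tau>"
    by blast
  have "regs \<tau> r = regs \<sigma> r" if "r \<in> {''i'', ''v'', ''m'', ''c'', ''j'', ''k'', ''y''}" for r
    using that by (intro agree_regs[OF \<tau>(1)]) auto
  then have "dp_le \<tau> (sem dp_update \<tau>)"
    using assms \<tau>(2) by (intro dp_update_le[OF \<tau>(3)]) simp_all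
  with \<tau>(5) show ?thesis unfolding \<tau>(4) by (rule dp_le_trans)
qed

lemma dp_body_effect:
  assumes "dp_ready \<sigma>" and i: "regs \<sigma> ''i'' = i" "i < n" and v: "regs \<sigma> ''v'' = v" "v < n"
    and m: "regs \<sigma> ''m'' = m" "m < Mx" and c: "regs \<sigma> ''c'' = c" "c \<le> b"
    and j: "regs \<sigma> ''j'' = j" "j < Suc (4 * b)" and k: "regs \<sigma> ''k'' = k" "k < Kx"
    and y: "regs \<sigma> ''y'' = y" "y < n"
    and A: "arrays \<sigma> ''A'' (sadr i v m c) \<noteq> 0" "assign i v m c j k"
  shows "(v, y) \<in> R \<Longrightarrow> arrays (sem dp_body \<sigma>) ''A'' (sadr (Suc i) y ((m + 2 ^ j) div 2) (c + k)) \<noteq> 0"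
    and "Suc i = length xs \<Longrightarrow> v = t \<Longrightarrow> regs (sem dp_body \<sigma>) ''out'' \<noteq> 0"
proof -
  from sem_dp_body[OF assms(1)] j obtain \<tau> where \<tau>: "agree shift_prog \<sigma> \<tau>"
    "regs \<tau> ''x'' = m div 2 ^ j" "dp_ready \<tau>"
    "sem dp_body \<sigma> = sem dp_update \<tau>" "dp_le \<sigma> \<tau>"
    using m by blast
  have "regs \<tau> r = regs \<sigma> r" if "r \<in> {''i'', ''v'', ''m'', ''c'', ''j'', ''k'', ''y''}" for r
    using that by (intro agree_regs[OF \<tau>(1)]) auto
  then have "regs \<tau> ''i'' = i" "regs \<tau> ''v'' = v" "regs \<tau> ''m'' = m" "regs \<tau> ''c'' = c" "regs \<tau> ''j'' = j"
    "regs \<tau> ''k'' = k" "regs \<tau> ''y'' = y"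
    using i v m c j k y by simp_all
  note sem = sem_dp_update[OF \<tau>(3) this(1) i(2) this(2) v(2) this(3) m(2) this(4) c(2) this(5) j(2) this(6) k(2) this(7) y(2) \<tau>(2)]
  have A': "arrays \<tau> ''A'' (sadr i v m c) \<noteq> 0" using \<tau>(5) A(1) unfolding dp_le_def by blast
  show "(v, y) \<in> R \<Longrightarrow> arrays (sem dp_body \<sigma>) ''A'' (sadr (Suc i) y ((m + 2 ^ j) div 2) (c + k)) \<noteq> 0"
    "Suc i = length xs \<Longrightarrow> v = t \<Longrightarrow> regs (sem dp_body \<sigma>) ''out'' \<noteq> 0"
    unfolding \<tau>(4) sem if_P[OF conjI[OF A' A(2)]]
    by (simp_all add: Let_def)
qed

text \<open>The nest meets every derivable state of level \<open>i\<close> together with every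
  admissible assignment and next vertex (\<open>visit\<close>): \<open>dp_le\<close> carries the
  table entry to that moment and the effect on to the end.\<close>

lemma sem_dp_nest:
  assumes rdy: "dp_ready \<sigma>" and i: "regs \<sigma> ''i'' = i" "i < n" and "dp_sound \<sigma>" "dp_upto i \<sigma>"
  shows "dp_sound (sem dp_nest \<sigma>)" "dp_upto (Suc i) (sem dp_nest \<sigma>)"
proof -
  let ?vars = "[(''v'', ''n''), (''m'', ''M''), (''c'', ''b1''), (''j'', ''W''), (''k'', ''K''), (''y'', ''n'')]"
  have fr: "dp_ready \<tau>" "regs \<tau> ''i'' = i" if "agree dp_nest \<sigma> \<tau>" for \<tau>
    using dp_ready_agree[OF rdy that] agree_regs[OF that, of "''i''"] i(1)
    by (simp_all add: base_regs_def base_arrays_def)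
  have bnd: "regs \<sigma> ''n'' = n" "regs \<sigma> ''M'' = Mx" "regs \<sigma> ''b1'' = b + 1" "regs \<sigma> ''W'' = Suc (4 * b)" "regs \<sigma> ''K'' = Kx"
    using rdy by (simp_all add: dp_ready_def base_def)
  have nst: "dp_le \<sigma> (sem dp_nest \<sigma>) \<and>
    (\<forall>vs. list_all2 (\<lambda>v x. v < regs \<sigma> (snd x)) vs ?vars \<longrightarrow>
      (\<exists>\<tau>. agree dp_nest \<sigma> \<tau> \<and> dp_le \<sigma> \<tau> \<and> dp_le (sem dp_body \<tau>) (sem dp_nest \<sigma>) \<and> map (regs \<tau> \<circ> fst) ?vars = vs))"
    unfolding dp_nest_def
  proof (rule sem_nest)
    fix \<tau> assume ag: "agree (nest ?vars dp_body) \<sigma> \<tau>"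
      and lt: "\<And>r N. (r, N) \<in> set ?vars \<Longrightarrow> regs \<tau> r < regs \<sigma> N"
    have ag': "agree dp_nest \<sigma> \<tau>" using ag by (simp add: dp_nest_def)
    show "dp_le \<tau> (sem dp_body \<tau>)"
      using fr[OF ag'] i(2) lt[of "''v''" "''n''"] lt[of "''m''" "''M''"] lt[of "''c''" "''b1''"] lt[of "''j''" "''W''"]
        lt[of "''k''" "''K''"] lt[of "''y''" "''n''"]
      by (intro dp_body_le) (simp_all add: bnd)
  next
    show "well_formed (nest ?vars dp_body)" using dp_nest_frame(4) by (simp only: dp_nest_def)
    show "bounds (nest ?vars dp_body) \<inter> wr (nest ?vars dp_body) = {}" by simp
    show "dp_le \<tau> \<tau>" for \<tau> by (simp add: dp_le_def)
    show "dp_le \<tau> \<rho>" if "dp_le \<tau> \<tau>'" "dp_le \<tau>' \<rho>" for \<tau> \<tau>' \<rho> using that by (rule dp_le_trans)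
    fix \<tau> r v assume "r \<in> fst ` set ?vars"
    then have "r \<noteq> ''out''" by auto
    then show "dp_le \<tau> (set_reg r v \<tau>)" by (simp add: dp_le_def dp_sound_def)
  qed
  then show "dp_sound (sem dp_nest \<sigma>)" using assms(4) by (simp add: dp_le_def)
  have visit: "((v, y) \<in> R \<longrightarrow> arrays (sem dp_nest \<sigma>) ''A'' (sadr (Suc i) y ((m + 2 ^ j) div 2) (c + k)) \<noteq> 0) \<and>
      (Suc i = length xs \<longrightarrow> v = t \<longrightarrow> regs (sem dp_nest \<sigma>) ''out'' \<noteq> 0)"
    if der: "der i v m c" and a: "assign i v m c j k" and y: "y < n" for v m c j k y
  proof -
    have lt: "v < n" "m < Mx" "c \<le> b" using der_lt[OF der] by auto
    have jk: "j < Suc (4 * b)" "k < Kx" using a unfolding assign_def by simp_all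
    have "list_all2 (\<lambda>v x. v < regs \<sigma> (snd x)) [v, m, c, j, k, y] ?vars"
      using lt jk y by (simp add: bnd)
    from mp[OF spec[OF conjunct2[OF nst]] this]
    obtain \<tau> where \<tau>: "agree dp_nest \<sigma> \<tau>" "dp_le \<sigma> \<tau>" "dp_le (sem dp_body \<tau>) (sem dp_nest \<sigma>)"
      "map (regs \<tau> \<circ> fst) ?vars = [v, m, c, j, k, y]"
      by (elim exE conjE)
    have "arrays \<sigma> ''A'' (sadr i v m c) \<noteq> 0" using assms(5) der unfolding dp_upto_def by blast
    then have A: "arrays \<tau> ''A'' (sadr i v m c) \<noteq> 0" using \<tau>(2) unfolding dp_le_def by blast
    have r: "regs \<tau> ''v'' = v" "regs \<tau> ''m'' = m" "regs \<tau> ''c'' = c" "regs \<tau> ''j'' = j" "regs \<tau> ''k'' = k" "regs \<tau> ''y'' = y"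
      using \<tau>(4) by simp_all
    note eff = dp_body_effect[OF fr(1)[OF \<tau>(1)] fr(2)[OF \<tau>(1)] i(2) r(1) lt(1) r(2) lt(2) r(3) lt(3) r(4) jk(1) r(5) jk(2) r(6) y A a]
    show ?thesis using eff \<tau>(3) unfolding dp_le_def by blast
  qed
  show "dp_upto (Suc i) (sem dp_nest \<sigma>)"
    unfolding dp_upto_def
  proof (intro conjI allI impI)
    fix i' v' m' c' assume i': "i' \<le> Suc i" "der i' v' m' c'"
    show "arrays (sem dp_nest \<sigma>) ''A'' (sadr i' v' m' c') \<noteq> 0"
    proof (cases "i' = Suc i")
      case False
      then have "i' \<le> i" using i'(1) by simp
      then have "arrays \<sigma> ''A'' (sadr i' v' m' c') \<noteq> 0" using assms(5) i'(2) unfolding dp_upto_def by blast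
      then show ?thesis using nst unfolding dp_le_def by blast
    next
      case True
      from i'(2)[unfolded True] show ?thesis
      proof (cases rule: der.cases)
        case (der_step v m c j k)
        then have "v' < n" using R by auto
        then show ?thesis using visit[of v m c j k v'] der_step unfolding True by simp
      qed
    qed
  next
    fix i' assume i': "i' < Suc i" "accept_at i'"
    show "regs (sem dp_nest \<sigma>) ''out'' \<noteq> 0"
    proof (cases "i' = i")
      case False
      then have "i' < i" using i'(1) by simp
      then have "regs \<sigma> ''out'' \<noteq> 0" using assms(5) i'(2) unfolding dp_upto_def by blast
      then show ?thesis using nst unfolding dp_le_def by blast
    next
      case True
      \<comment> \<open>The acceptance test sits inside the loop over \<open>y\<close>, so some
        value of \<open>y\<close> must be supplied; \<open>s\<close> shows that there is
        one.\<close>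
      with i'(2) show ?thesis using visit[of t _ _ _ _ s] s unfolding accept_at_def by blast
    qed
  qed
qed

lemma sem_dp_prog:
  assumes rdy: "dp_ready \<sigma>" and A: "\<And>a. arrays \<sigma> ''A'' a = 0" and out: "regs \<sigma> ''out'' = 0"
  shows "regs (sem dp_prog \<sigma>) ''out'' = (if accept then 1 else 0)"
proof -
  define \<sigma>1 where "\<sigma>1 = sem (LStore ''A'' (Load ''rv'' (Reg ''s'')) (Const 1)) \<sigma>"
  have "regs \<sigma> ''s'' = s" "arrays \<sigma> ''rv'' s = s * (Mx * (b + 1))"
    using rdy s by (simp_all add: dp_ready_def base_def)
  then have \<sigma>1: "\<sigma>1 = set_cell ''A'' (sadr 0 s 0 0) 1 \<sigma>"
    by (simp add: \<sigma>1_def sadr_def algebra_simps)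
  have rdy1: "dp_ready \<sigma>1"
    unfolding \<sigma>1_def by (rule dp_ready_agree[OF rdy agree_sem]) (auto simp: base_regs_def base_arrays_def)
  have regn: "regs \<sigma>1 ''n'' = n" using rdy1 by (simp add: dp_ready_def base_def)
  have sound1: "dp_sound \<sigma>1"
    using A out der_start s sadr_inj[of _ _ _ s 0 0 _ 0] by (auto simp: \<sigma>1 dp_sound_def split: if_splits)
  have "arrays \<sigma>1 ''A'' (sadr 0 v m c) \<noteq> 0" if "der 0 v m c" for v m c
    using that by cases (simp add: \<sigma>1)
  then have upto1: "dp_upto 0 \<sigma>1" by (simp add: dp_upto_def)
  have "dp_sound (sem (LFor ''i'' ''n'' dp_nest) \<sigma>1) \<and> dp_upto n (sem (LFor ''i'' ''n'' dp_nest) \<sigma>1)"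
  proof (rule sem_LFor_induct[where P = "\<lambda>i \<tau>. dp_sound \<tau> \<and> dp_upto i \<tau>"])
    show "dp_sound \<sigma>1 \<and> dp_upto 0 \<sigma>1" using sound1 upto1 by simp
    show "dp_sound (set_reg ''i'' (regs \<sigma>1 ''n'') \<tau>) \<and> dp_upto n (set_reg ''i'' (regs \<sigma>1 ''n'') \<tau>)"
      if "dp_sound \<tau> \<and> dp_upto (regs \<sigma>1 ''n'') \<tau>" for \<tau>
      using that regn by (simp add: dp_sound_def dp_upto_def)
    fix i \<tau> assume i: "i < regs \<sigma>1 ''n''" and P: "dp_sound \<tau> \<and> dp_upto i \<tau>"
      and ag: "agree (LFor ''i'' ''n'' dp_nest) \<sigma>1 \<tau>"
    let ?\<tau> = "set_reg ''i'' i \<tau>"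
    have "dp_ready ?\<tau>"
      by (rule dp_ready_agree[OF rdy1 agree_set_reg[OF ag]]) (auto simp: base_regs_def base_arrays_def)
    moreover have "dp_sound ?\<tau>" "dp_upto i ?\<tau>" using P by (simp_all add: dp_sound_def dp_upto_def)
    ultimately show "dp_sound (sem dp_nest ?\<tau>) \<and> dp_upto (Suc i) (sem dp_nest ?\<tau>)"
      using sem_dp_nest[of ?\<tau> i] i regn by simp
  qed
  moreover have "sem dp_prog \<sigma> = sem (LFor ''i'' ''n'' dp_nest) \<sigma>1"
    by (simp only: dp_prog_def \<sigma>1_def sem.simps(4))
  \<comment> \<open>The \<open>n\<close> passes suffice: acceptance happens at number
    \<open>length xs - 1\<close>, and a list of distinct vertices has at most \<open>n\<close>
    entries.\<close>
  moreover have "\<exists>i<n. accept_at i" if accept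
  proof -
    from that obtain i where "accept_at i" "Suc i = length xs" unfolding accept_def accept_at_def by blast
    then show ?thesis using length_layered_tokens[of R s S n Kx] by (intro exI[of _ i]) simp
  qed
  ultimately have "dp_sound (sem dp_prog \<sigma>)" "accept \<Longrightarrow> regs (sem dp_prog \<sigma>) ''out'' \<noteq> 0"
    unfolding dp_upto_def by auto
  moreover from this(1) have "regs (sem dp_prog \<sigma>) ''out'' \<le> 1" "regs (sem dp_prog \<sigma>) ''out'' \<noteq> 0 \<Longrightarrow> accept"
    unfolding dp_sound_def by blast+
  ultimately show ?thesis by (metis le_antisym le_numeral_extra(4) less_one linorder_not_le)
qed

end

section \<open>From the loaded input to the answer\<close>

context spd_prog
begin

definition loaded :: "state \<Rightarrow> bool" where
  "loaded \<sigma> \<longleftrightarrow>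
     regs \<sigma> ''n'' = n \<and> regs \<sigma> ''s'' = s \<and> regs \<sigma> ''t'' = t \<and> regs \<sigma> ''b1'' = b + 1 \<and> regs \<sigma> ''w'' = 2 * b \<and>
     regs \<sigma> ''W'' = Suc (4 * b) \<and> regs \<sigma> ''K'' = Kx \<and> regs \<sigma> ''n4'' = n + 4 \<and> regs \<sigma> ''M'' = Mx \<and>
     (\<forall>u<n. \<forall>v<n. arrays \<sigma> ''in'' (n + 4 + (u * n + v)) \<noteq> 0 \<longleftrightarrow> (u, v) \<in> R) \<and>
     (\<forall>v<n. arrays \<sigma> ''in'' (v + 4) \<noteq> 0 \<longleftrightarrow> v \<in> S) \<and>
     (\<forall>j<Suc (4 * b). arrays \<sigma> ''pw'' j = 2 ^ j)"

lemma sem_tab_prog: "loaded \<sigma> \<Longrightarrow> base (sem tab_prog \<sigma>)"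
  unfolding loaded_def base_def tab_prog_def
  by (simp add: sem_mul_tab del: power_Suc)

lemma sem_main_prog:
  assumes "loaded \<sigma>" "\<And>m. m \<notin> {''in'', ''pw''} \<Longrightarrow> arrays \<sigma> m = (\<lambda>_. 0)" "regs \<sigma> ''out'' = 0" "regs \<sigma> ''cnt'' = 0"
  shows "regs (sem main_prog \<sigma>) ''out'' = (if accept then 1 else 0)"
proof -
  define \<sigma>1 \<sigma>2 \<sigma>3 where "\<sigma>1 = sem tab_prog \<sigma>" "\<sigma>2 = sem walk_prog \<sigma>1" "\<sigma>3 = sem token_prog \<sigma>2"
  have ag: "agree tab_prog \<sigma> \<sigma>1" "agree walk_prog \<sigma>1 \<sigma>2" "agree token_prog \<sigma>2 \<sigma>3"
    by (simp_all add: \<sigma>1_\<sigma>2_\<sigma>3_def)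
  have 1: "base \<sigma>1" unfolding \<sigma>1_\<sigma>2_\<sigma>3_def(1) using assms(1) by (rule sem_tab_prog)
  have 2: "base \<sigma>2" by (rule base_agree[OF 1 ag(2)]) (auto simp: base_regs_def base_arrays_def)
  have 3: "base \<sigma>3" by (rule base_agree[OF 2 ag(3)]) (auto simp: base_regs_def base_arrays_def)
  have "arrays \<sigma>1 ''wk'' a = 0" for a
    using assms(2)[of "''wk''"] agree_arrays[OF ag(1), of "''wk''"] by simp
  with 1 have wk2: "walks_ok \<sigma>2" unfolding \<sigma>1_\<sigma>2_\<sigma>3_def(2) by (rule sem_walk_prog)
  have "tokens_ok [] \<sigma>2"
    using assms(2)[of "''tok''"] assms(2)[of "''placed''"] assms(4)
    by (simp add: tokens_ok_def \<sigma>1_\<sigma>2_\<sigma>3_def)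
  with 2 wk2 have tok: "tokens_ok xs \<sigma>3" unfolding \<sigma>1_\<sigma>2_\<sigma>3_def(3) by (rule sem_token_prog)
  have "arrays \<sigma>3 ''wk'' = arrays \<sigma>2 ''wk''" by (rule agree_arrays[OF ag(3)]) simp
  with wk2 have "walks_ok \<sigma>3" by (simp add: walks_ok_def)
  with 3 tok have "dp_ready \<sigma>3" unfolding dp_ready_def tokens_ok_def by blast
  moreover have "arrays \<sigma>3 ''A'' a = 0" for a
    using assms(2)[of "''A''"] by (simp add: \<sigma>1_\<sigma>2_\<sigma>3_def)
  moreover have "regs \<sigma>3 ''out'' = 0" using assms(3) by (simp add: \<sigma>1_\<sigma>2_\<sigma>3_def)
  ultimately have "regs (sem dp_prog \<sigma>3) ''out'' = (if accept then 1 else 0)" by (rule sem_dp_prog)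
  then show ?thesis unfolding main_prog_def sem.simps(4) \<sigma>1_\<sigma>2_\<sigma>3_def .
qed

end

lemma main_prog_frame:
  "wr main_prog = {''q'', ''nn'', ''kk'', ''Q'', ''Z'', ''zz'', ''u'', ''k'', ''v'', ''x'', ''cnt'', ''i'', ''m'', ''c'', ''j'', ''y'', ''out''}"
  "bounds main_prog = {''n'', ''K'', ''M'', ''b1'', ''W''}" "well_formed main_prog"
  unfolding main_prog_def by auto

section \<open>Input encoding and the parameter factor\<close>

lemma nth_concat_map:
  assumes "\<And>u. u < n \<Longrightarrow> length (g u) = l" "u < n" "v < l"
  shows "concat (map g [0..<n]) ! (u * l + v) = g u ! v"
  using assms
proof (induction n)
  case (Suc n)
  have len: "length (concat (map g [0..<k])) = k * l" if "k \<le> Suc n" for k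
    using that Suc.prems(1) by (induction k) auto
  show ?case
  proof (cases "u = n")
    case True
    then show ?thesis using len[of n] by (simp add: nth_append)
  next
    case False
    then have "u < n" using Suc.prems(2) by simp
    then have "u * l + v < n * l"
      using Suc.prems(3) mult_le_mono1[of "Suc u" n l] by simp
    then show ?thesis using len[of n] Suc \<open>u < n\<close> by (simp add: nth_append)
  qed
qed simp

lemma length_concat_map:
  "(\<And>u. u < n \<Longrightarrow> length (g u) = l) \<Longrightarrow> length (concat (map g [0..<n])) = n * l"
  by (induction n) auto

lemma length_le_input_size: "length w \<le> input_size w"
  by (induction w) (auto simp: input_size_def)

text \<open>Constant factors are unrolled into sums, in place of multiplication.\<close>

primrec times_expr :: "nat \<Rightarrow> aexp \<Rightarrow> aexp" where
  "times_expr 0 a = Const 0"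
| "times_expr (Suc c) a = Plus a (times_expr c a)"

lemma aval_times_expr [simp]: "aval (times_expr c a) \<sigma> = c * aval a \<sigma>"
  by (induction c) auto

text \<open>This is the parameter factor of the running time. The exponent is assigned in
  \<open>p1\<close> and is a loop bound in \<open>p2\<close>, hence two separately compiled
  pieces.\<close>

lemma computable_exponential: "computable (\<lambda>b. K * 2 ^ ((4 * b + 3) * e))"
proof -
  define p1 where "p1 = LAssign ''N'' (times_expr e (Plus (times_expr 4 (Load ''in'' (Const 0))) (Const 3)))"
  define p2 where "p2 = LSeq (LAssign ''acc'' (Const 1))
    (LSeq (LFor ''q'' ''N'' (LAssign ''acc'' (Plus (Reg ''acc'') (Reg ''acc''))))
      (LAssign ''out'' (times_expr K (Reg ''acc''))))"
  have "\<exists>k. halts_with (Seq (compile p1) (compile p2)) [b] k (K * 2 ^ ((4 * b + 3) * e))" for b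
  proof -
    define \<sigma> where "\<sigma> = sem p1 (initial_state [b])"
    have N: "regs \<sigma> ''N'' = (4 * b + 3) * e" by (simp add: \<sigma>_def p1_def initial_state_def)
    obtain k where "exec (compile p1) (initial_state [b]) k \<sigma>"
      using exec_compile[of p1 "initial_state [b]" 0] unfolding \<sigma>_def by (auto simp: p1_def)
    moreover obtain l where "exec (compile p2) \<sigma> l (sem p2 \<sigma>)"
      using exec_compile[of p2 \<sigma> "regs \<sigma> ''N''"] by (auto simp: p2_def)
    moreover have "regs (sem (LFor ''q'' ''N'' (LAssign ''acc'' (Plus (Reg ''acc'') (Reg ''acc'')))) (set_reg ''acc'' 1 \<sigma>)) ''acc''
        = 2 ^ ((4 * b + 3) * e)"
      by (rule sem_LFor_induct[where P = "\<lambda>i \<tau>. regs \<tau> ''acc'' = 2 ^ i"]) (simp_all add: N)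
    then have "regs (sem p2 \<sigma>) ''out'' = K * 2 ^ ((4 * b + 3) * e)"
      by (simp add: p2_def)
    ultimately show ?thesis unfolding halts_with_def by (blast intro: exec_Seq)
  qed
  then show ?thesis unfolding computable_def by blast
qed

text \<open>\<open>X\<close> adds up the number of masks, the number of vertices and
  \<open>b + 1\<close>, and so dominates all loop bounds at once.\<close>

lemma spd_prog_correct:
  assumes x: "x \<in> spd_instances"
  defines "prog \<equiv> Seq (compile setup_prog) (Seq (compile pow_prog) (compile main_prog))"
  defines "X \<equiv> 2 ^ Suc (4 * spd_b x) + card (pverts (spd_graph x)) + spd_b x + 1"
  shows "\<exists>k. k \<le> time_bound (LSeq setup_prog (LSeq pow_prog main_prog)) X \<and>
    halts_with prog (spd_encode x) k (if x \<in> spd_yes_instances then 1 else 0)"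
proof -
  define G R s t S b where "G = spd_graph x" "R = parcs (spd_graph x)" "s = spd_s x" "t = spd_t x"
    "S = spd_S x" "b = spd_b x"
  note defs = this
  obtain n where n: "pverts G = {..<n}" using x by (auto simp: spd_instances_def defs)
  have card: "card (pverts G) = n" by (simp add: n)
  have G: "pair_graph G" "s < n" "t < n" using x n by (auto simp: spd_instances_def defs)
  interpret pair_graph G by (rule G(1))
  have "R \<subseteq> {..<n} \<times> {..<n}"
    using in_arcsD1 in_arcsD2 n by (auto simp: defs)
  with G interpret spd_prog n s t b S R by unfold_locales
  let ?w = "spd_encode x"
  let ?chi = "map (\<lambda>v. if v \<in> S then 1 else 0 :: nat) [0..<n]"
  let ?row = "\<lambda>u. map (\<lambda>v. if (u, v) \<in> R then 1 else 0 :: nat) [0..<n]"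
  have w: "?w = [n, s, t, b] @ ?chi @ concat (map ?row [0..<n])"
    by (simp add: spd_encode_def Let_def defs card[unfolded defs])
  have len: "length ?w = 4 + n + n * n"
    by (simp add: w length_concat_map[of n ?row n] del: length_concat)
  have w03: "?w ! 0 = n" "?w ! 1 = s" "?w ! 2 = t" "?w ! 3 = b"
    by (simp_all add: w numeral_eq_Suc)
  have wS: "?w ! (v + 4) = (if v \<in> S then 1 else 0)" if "v < n" for v
  proof -
    have "?w ! (v + 4) = (?chi @ concat (map ?row [0..<n])) ! v"
      unfolding w by (subst nth_append_right) simp_all
    also have "\<dots> = ?chi ! v" using that by (subst nth_append_left) simp_all
    finally show ?thesis using that by simp
  qed
  have wR: "?w ! (n + 4 + (u * n + v)) = (if (u, v) \<in> R then 1 else 0)" if "u < n" "v < n" for u v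
  proof -
    have "?w ! (n + 4 + (u * n + v)) = (?chi @ concat (map ?row [0..<n])) ! (n + (u * n + v))"
      unfolding w by (subst nth_append_right) simp_all
    also have "\<dots> = concat (map ?row [0..<n]) ! (u * n + v)" by (subst nth_append_right) simp_all
    also have "\<dots> = ?row u ! v" using that by (intro nth_concat_map) simp_all
    finally show ?thesis using that by simp
  qed
  let ?\<sigma> = "initial_state ?w"
  have in_eq: "arrays ?\<sigma> ''in'' i = ?w ! i" if "i < 4 + n + n * n" for i
    using that by (simp add: initial_state_def len)
  have "u * n + v < n * n" if "u < n" "v < n" for u v
    using that mult_le_mono1[of "Suc u" n n] by simp
  then have inp: "arrays ?\<sigma> ''in'' 0 = n" "arrays ?\<sigma> ''in'' (Suc 0) = s" "arrays ?\<sigma> ''in'' 2 = t" "arrays ?\<sigma> ''in'' 3 = b"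
    "\<forall>u<n. \<forall>v<n. arrays ?\<sigma> ''in'' (n + 4 + (u * n + v)) \<noteq> 0 \<longleftrightarrow> (u, v) \<in> R"
    "\<forall>v<n. arrays ?\<sigma> ''in'' (v + 4) \<noteq> 0 \<longleftrightarrow> v \<in> S"
    using w03 wS wR by (simp_all add: in_eq)
  define \<sigma>1 \<sigma>2 where "\<sigma>1 = sem setup_prog ?\<sigma>" "\<sigma>2 = sem pow_prog \<sigma>1"
  have r1: "regs \<sigma>1 ''n'' = n" "regs \<sigma>1 ''s'' = s" "regs \<sigma>1 ''t'' = t" "regs \<sigma>1 ''b1'' = b + 1" "regs \<sigma>1 ''w'' = 2 * b"
    "regs \<sigma>1 ''W'' = Suc (4 * b)" "regs \<sigma>1 ''K'' = n + b + 1" "regs \<sigma>1 ''n4'' = n + 4"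
    using inp(1-4) by (simp_all add: \<sigma>1_\<sigma>2_def(1) setup_prog_def)
  have a1: "arrays \<sigma>1 = arrays ?\<sigma>" by (rule ext) (simp add: \<sigma>1_\<sigma>2_def(1))
  have "loaded \<sigma>2"
    using inp(5,6) r1 by (simp add: loaded_def \<sigma>1_\<sigma>2_def(2) sem_pow_prog a1 del: power_Suc)
  moreover have "arrays \<sigma>2 m = (\<lambda>_. 0)" if "m \<notin> {''in'', ''pw''}" for m
    using that by (simp add: \<sigma>1_\<sigma>2_def(2) a1 initial_state_def)
  moreover have "regs \<sigma>2 ''out'' = 0" "regs \<sigma>2 ''cnt'' = 0"
    by (simp_all add: \<sigma>1_\<sigma>2_def initial_state_def)
  ultimately have out: "regs (sem main_prog \<sigma>2) ''out'' = (if accept then 1 else 0)"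
    by (rule sem_main_prog)
  have X: "X = 2 ^ Suc (4 * b) + n + b + 1" using card by (simp add: X_def defs)
  \<comment> \<open>The window length \<open>W\<close> is the one bound that is not visibly a part
    of the sum; it is below the number of masks.\<close>
  have "Suc (4 * b) < 2 ^ Suc (4 * b)" by (rule less_exp)
  then have bnd: "regs \<sigma>1 ''W'' \<le> X" using r1 X by linarith
  obtain k1 where k1: "k1 \<le> time_bound setup_prog X" "exec (compile setup_prog) ?\<sigma> k1 \<sigma>1"
    using exec_compile[of setup_prog ?\<sigma> X] unfolding \<sigma>1_\<sigma>2_def(1) by auto
  obtain k2 where k2: "k2 \<le> time_bound pow_prog X" "exec (compile pow_prog) \<sigma>1 k2 \<sigma>2"
    using exec_compile[of pow_prog \<sigma>1 X] bnd unfolding \<sigma>1_\<sigma>2_def(2) by auto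
  have "regs \<sigma>2 N \<le> X" if "N \<in> bounds main_prog" for N
  proof -
    have "regs \<sigma>2 ''n'' = n" "regs \<sigma>2 ''K'' = n + b + 1" "regs \<sigma>2 ''b1'' = b + 1" "regs \<sigma>2 ''W'' = Suc (4 * b)"
      "regs \<sigma>2 ''M'' = 2 ^ Suc (4 * b)"
      using \<open>loaded \<sigma>2\<close> unfolding loaded_def by blast+
    then show ?thesis using that X bnd r1(6) unfolding main_prog_frame by auto
  qed
  then obtain k3 where k3: "k3 \<le> time_bound main_prog X" "exec (compile main_prog) \<sigma>2 k3 (sem main_prog \<sigma>2)"
    using exec_compile[of main_prog \<sigma>2 X] main_prog_frame by auto
  have "exec prog ?\<sigma> (k1 + (k2 + k3)) (sem main_prog \<sigma>2)"
    unfolding prog_def using k1(2) k2(2) k3(2) by (intro exec_Seq)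
  moreover have "accept \<longleftrightarrow> x \<in> spd_yes_instances"
    using spd_yes_iff_accept[OF x] n by (simp add: defs)
  with out have "regs (sem main_prog \<sigma>2) ''out'' = (if x \<in> spd_yes_instances then 1 else 0)"
    by (simp only:)
  moreover have "k1 + (k2 + k3) \<le> time_bound (LSeq setup_prog (LSeq pow_prog main_prog)) X"
    using k1(1) k2(1) k3(1) by simp
  ultimately show ?thesis unfolding halts_with_def by blast
qed

theorem theorem4p4:
  shows "fixed_parameter_tractable spd_instances spd_encode spd_b spd_yes_instances"
proof -
  let ?prog = "Seq (compile setup_prog) (Seq (compile pow_prog) (compile main_prog))"
  obtain K e where Ke: "\<And>M. time_bound (LSeq setup_prog (LSeq pow_prog main_prog)) M \<le> K * Suc M ^ e"
    using time_bound_polynomial by blast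
  have "\<exists>k \<le> K * 2 ^ ((4 * spd_b x + 3) * e) * input_size (spd_encode x) ^ e.
      halts_with ?prog (spd_encode x) k (if x \<in> spd_yes_instances then 1 else 0)"
    if x: "x \<in> spd_instances" for x
  proof -
    let ?b = "spd_b x" and ?n = "card (pverts (spd_graph x))" and ?N = "input_size (spd_encode x)"
    let ?X = "2 ^ Suc (4 * ?b) + ?n + ?b + 1"
    obtain k where k: "k \<le> time_bound (LSeq setup_prog (LSeq pow_prog main_prog)) ?X"
      "halts_with ?prog (spd_encode x) k (if x \<in> spd_yes_instances then 1 else 0)"
      using spd_prog_correct[OF x] by blast
    have "?n + 4 \<le> length (spd_encode x)" by (simp add: spd_encode_def Let_def)
    then have N: "?n \<le> ?N" "1 \<le> ?N" using length_le_input_size[of "spd_encode x"] by linarith+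
    \<comment> \<open>Being written in binary, \<open>b\<close> is not bounded by the input size; it
      is absorbed into the parameter factor instead.\<close>
    have b: "?b + 2 \<le> 2 ^ Suc (4 * ?b)"
    proof -
      have "Suc ?b \<le> 2 ^ ?b" by (rule Suc_leI[OF less_exp])
      also have "\<dots> \<le> 2 ^ (4 * ?b)" by (intro power_increasing) auto
      finally show ?thesis unfolding power_Suc using one_le_power[of 2 "4 * ?b"] by linarith
    qed
    have "Suc ?X \<le> 2 * 2 ^ Suc (4 * ?b) + ?N" using b N(1) by linarith
    \<comment> \<open>Both summands are at least 1, so each is at most their product. Doubling that
      product gives the exponent \<open>4 * b + 3\<close>.\<close>
    also have "\<dots> \<le> 2 * 2 ^ Suc (4 * ?b) * ?N + 2 * 2 ^ Suc (4 * ?b) * ?N"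
      using N(2) by (intro add_mono) (simp_all add: Suc_le_eq)
    also have "\<dots> = 2 ^ (4 * ?b + 3) * ?N" by (simp add: power_add)
    finally have "Suc ?X ^ e \<le> (2 ^ (4 * ?b + 3) * ?N) ^ e" by (rule power_mono) simp
    then have "K * Suc ?X ^ e \<le> K * 2 ^ ((4 * ?b + 3) * e) * ?N ^ e"
      by (simp add: power_mult_distrib power_mult)
    with k Ke[of ?X] show ?thesis by (meson le_trans)
  qed
  then show ?thesis
    unfolding fixed_parameter_tractable_def
    by (intro exI[of _ ?prog] exI[of _ "\<lambda>b. K * 2 ^ ((4 * b + 3) * e)"] exI[of _ e] conjI
      computable_exponential) blast
qed

end
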